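(* Let $G$ be a finite group, $p$ a prime, and $n \ge 2$ an integer. For $\phi \in \mathrm{Irr}(G)$ define \[ \gamma_n(\phi) = \sum_{\chi_1,\dots,\chi_n \in \mathrm{Irr}(G)} \Big[\phi,\ \prod_{i=1}^{n}\chi_i\overline{\chi_i}\Big], \qquad \delta_n(\phi) = \sum_{\chi_1,\dots,\chi_n \in \mathrm{Irr}(G)} \Big[\phi,\ \prod_{i=1}^{n}\chi_i^{2}\Big]. \] Then: (1) $G$ has a conjugacy class of $p$-defect $0$ if and only if there exists $\phi \in \mathrm{Irr}(G)$ such that $\gamma_n(\phi)$ is not divisible by $p$. (2) $G$ has a real conjugacy class of $p$-defect $0$ if and only if there exists $\phi \in \mathrm{Irr}(G)$ such that $\delta_n(\phi)$ is not divisible by $p$.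
   Context: $\mathrm{Irr}(G)$ is the set of irreducible complex characters of $G$, $\overline{\chi}$ is the complex conjugate character, and $[\alpha,\beta] = \frac{1}{|G|}\sum_{g\in G}\alpha(g)\overline{\beta(g)}$ is the usual inner product of class functions; the sums run over all $n$-tuples of irreducible characters (repetition allowed). A conjugacy class $K$ of $G$ has $p$-defect $0$ if $|K|_p = |G|_p$, where $m_p$ denotes the largest power of $p$ dividing the integer $m$. A conjugacy class $K$ is real if $K = K^{-1} = \{g^{-1} : g\in K\}$. *)

theory Defs
  imports "HOL-Computational_Algebra.Primes" "HOL-Algebra.Group" "Jordan_Normal_Form.Matrix"
begin

definition is_rep :: "('a, 'b) monoid_scheme \<Rightarrow> nat \<Rightarrow> ('a \<Rightarrow> complex mat) \<Rightarrow> bool" where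
  "is_rep G d \<rho> \<longleftrightarrow>
     (\<forall>g \<in> carrier G. \<rho> g \<in> carrier_mat d d) \<and>
     \<rho> \<one>\<^bsub>G\<^esub> = 1\<^sub>m d \<and>
     (\<forall>g \<in> carrier G. \<forall>h \<in> carrier G. \<rho> (g \<otimes>\<^bsub>G\<^esub> h) = \<rho> g * \<rho> h)"

definition is_subspace :: "nat \<Rightarrow> complex vec set \<Rightarrow> bool" where
  "is_subspace d W \<longleftrightarrow> W \<subseteq> carrier_vec d \<and> 0\<^sub>v d \<in> W \<and>
     (\<forall>v \<in> W. \<forall>w \<in> W. v + w \<in> W) \<and> (\<forall>c. \<forall>v \<in> W. c \<cdot>\<^sub>v v \<in> W)"

definition is_irr_rep :: "('a, 'b) monoid_scheme \<Rightarrow> nat \<Rightarrow> ('a \<Rightarrow> complex mat) \<Rightarrow> bool" where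
  "is_irr_rep G d \<rho> \<longleftrightarrow> is_rep G d \<rho> \<and> d > 0 \<and>
     (\<forall>W. is_subspace d W \<and> (\<forall>g \<in> carrier G. \<forall>w \<in> W. \<rho> g *\<^sub>v w \<in> W)
        \<longrightarrow> W = {0\<^sub>v d} \<or> W = carrier_vec d)"

definition mat_trace :: "complex mat \<Rightarrow> complex" where
  "mat_trace A = (\<Sum>i<dim_row A. A $$ (i, i))"

definition character :: "('a, 'b) monoid_scheme \<Rightarrow> ('a \<Rightarrow> complex mat) \<Rightarrow> 'a \<Rightarrow> complex" where
  "character G \<rho> = (\<lambda>g. if g \<in> carrier G then mat_trace (\<rho> g) else 0)"

definition Irr :: "('a, 'b) monoid_scheme \<Rightarrow> ('a \<Rightarrow> complex) set" where
  "Irr G = {\<chi>. \<exists>d \<rho>. is_irr_rep G d \<rho> \<and> \<chi> = character G \<rho>}"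

definition cf_inner :: "('a, 'b) monoid_scheme \<Rightarrow> ('a \<Rightarrow> complex) \<Rightarrow> ('a \<Rightarrow> complex) \<Rightarrow> complex" where
  "cf_inner G \<alpha> \<beta> = (\<Sum>g \<in> carrier G. \<alpha> g * cnj (\<beta> g)) / of_nat (card (carrier G))"

definition gamma_n :: "('a, 'b) monoid_scheme \<Rightarrow> nat \<Rightarrow> ('a \<Rightarrow> complex) \<Rightarrow> complex" where
  "gamma_n G n \<phi> = (\<Sum>\<chi> \<in> Pi\<^sub>E {..<n} (\<lambda>_. Irr G).
      cf_inner G \<phi> (\<lambda>g. \<Prod>i<n. \<chi> i g * cnj (\<chi> i g)))"

definition delta_n :: "('a, 'b) monoid_scheme \<Rightarrow> nat \<Rightarrow> ('a \<Rightarrow> complex) \<Rightarrow> complex" where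
  "delta_n G n \<phi> = (\<Sum>\<chi> \<in> Pi\<^sub>E {..<n} (\<lambda>_. Irr G).
      cf_inner G \<phi> (\<lambda>g. \<Prod>i<n. (\<chi> i g)^2))"

definition conj_class :: "('a, 'b) monoid_scheme \<Rightarrow> 'a \<Rightarrow> 'a set" where
  "conj_class G g = {h \<otimes>\<^bsub>G\<^esub> g \<otimes>\<^bsub>G\<^esub> inv\<^bsub>G\<^esub> h | h. h \<in> carrier G}"

definition is_conj_class :: "('a, 'b) monoid_scheme \<Rightarrow> 'a set \<Rightarrow> bool" where
  "is_conj_class G K \<longleftrightarrow> (\<exists>g \<in> carrier G. K = conj_class G g)"

definition p_part :: "nat \<Rightarrow> nat \<Rightarrow> nat" where
  "p_part p m = p ^ multiplicity p m"

definition p_defect_zero :: "('a, 'b) monoid_scheme \<Rightarrow> nat \<Rightarrow> 'a set \<Rightarrow> bool" where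
  "p_defect_zero G p K \<longleftrightarrow> p_part p (card K) = p_part p (card (carrier G))"

definition real_class :: "('a, 'b) monoid_scheme \<Rightarrow> 'a set \<Rightarrow> bool" where
  "real_class G K \<longleftrightarrow> (\<lambda>x. inv\<^bsub>G\<^esub> x) ` K = K"

definition not_div_by :: "nat \<Rightarrow> complex \<Rightarrow> bool" where
  "not_div_by p z \<longleftrightarrow> \<not> (\<exists>m::int. z = of_int (int p * m))"

end

theory Submission
  imports Defs "Jordan_Normal_Form.Spectral_Radius" "HOL-Algebra.Multiplicative_Group"
begin

text \<open>By column orthogonality \<open>\<Sum>\<^sub>\<chi> \<chi>(g) \<chi>(g)\<^sup>*\<close> is the order of the centralizer \<open>C(g)\<close>, and
  \<open>\<Sum>\<^sub>\<chi> \<chi>(g)\<^sup>2\<close> is \<open>|C(g)|\<close> if \<open>g\<close> is real and 0 otherwise. Hence both invariants have the form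
  \<open>F(\<phi>) = |G|\<^sup>-\<^sup>1 \<Sum>\<^sub>g \<phi>(g) |C(g)|\<^sup>n = \<Sum>\<^sub>K \<phi>(g\<^sub>K) |C(g\<^sub>K)|\<^sup>n\<^sup>-\<^sup>1\<close>, summed over the classes \<open>K\<close> in a conjugation
  invariant set \<open>S\<close>, and \<open>F(\<phi>)\<close> is an integer because it is a sum of multiplicities.
  A class has \<open>p\<close>-defect 0 iff \<open>p\<close> does not divide \<open>|C(g\<^sub>K)|\<close>. If \<open>p\<close> divides all these orders, then \<open>F(\<phi>) / p\<close>
  is a rational algebraic integer, thus an integer. Conversely \<open>\<Sum>\<^sub>\<phi> F(\<phi>) \<phi>(h)\<^sup>* = |C(h)|\<^sup>n\<close> for \<open>h\<close> in \<open>S\<close>,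
  so if \<open>p\<close> divides every \<open>F(\<phi>)\<close>, then \<open>|C(h)|\<^sup>n / p\<close> is a rational algebraic integer and \<open>p\<close> divides \<open>|C(h)|\<close>.\<close>

section \<open>Traces of complex matrices\<close>

lemma mat_trace_mult:
  assumes "A \<in> carrier_mat n m" "B \<in> carrier_mat m n"
  shows "mat_trace (A * B) = (\<Sum>i<n. \<Sum>j<m. A $$ (i, j) * B $$ (j, i))"
  using assms by (auto simp: mat_trace_def scalar_prod_def atLeast0LessThan intro!: sum.cong)

lemma mat_trace_mult_comm:
  assumes "A \<in> carrier_mat n m" "B \<in> carrier_mat m n"
  shows "mat_trace (A * B) = mat_trace (B * A)"
  unfolding mat_trace_mult[OF assms] mat_trace_mult[OF assms(2,1)]
  by (subst sum.swap) (simp add: mult.commute)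

lemma mat_trace_similar:
  assumes "A \<in> carrier_mat n n" "similar_mat_wit A B P Q"
  shows "mat_trace A = mat_trace B"
proof -
  note w = similar_mat_witD2[OF assms]
  have "mat_trace A = mat_trace (Q * (P * B))"
    unfolding w(3) by (rule mat_trace_mult_comm[of _ n n]) (use w in auto)
  also have "Q * (P * B) = Q * P * B"
    by (rule assoc_mult_mat[symmetric, of _ n n _ n _ n]) (use w in auto)
  finally show ?thesis using w by simp
qed

text \<open>In the sum over \<open>l\<close> for entry \<open>(i, j)\<close> of
  \<open>?C * B\<close> only indices with i \<le> l \<le> j contribute. Below the diagonal there are
  none, on the diagonal only l = i.\<close>

lemma upper_triangular_pow:
  assumes B: "B \<in> carrier_mat n n" "upper_triangular (B :: 'a :: comm_ring_1 mat)"
  shows "upper_triangular (B ^\<^sub>m k) \<and> (\<forall>i<n. (B ^\<^sub>m k) $$ (i, i) = (B $$ (i, i)) ^ k)"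
proof (induction k)
  case 0
  show ?case using B by auto
next
  case (Suc k)
  let ?C = "B ^\<^sub>m k"
  have C: "?C \<in> carrier_mat n n" using B by (simp add: pow_carrier_mat)
  have entry: "(?C * B) $$ (i, j) = (\<Sum>l<n. ?C $$ (i, l) * B $$ (l, j))" if "i < n" "j < n" for i j
    using that B C by (auto simp: scalar_prod_def atLeast0LessThan)
  have lo: "?C $$ (i, l) = 0" if "l < i" "i < n" for i l
    using Suc that C upper_triangularD[of ?C l i] by auto
  have loB: "B $$ (l, j) = 0" if "j < l" "l < n" for l j
    using that B upper_triangularD[of B j l] by auto
  have "(?C * B) $$ (i, j) = 0" if "j < i" "i < n" for i j
  proof -
    have "?C $$ (i, l) * B $$ (l, j) = 0" if "l < n" for l
      using lo[of l i] loB[of j l] \<open>j < i\<close> \<open>i < n\<close> that by (cases "l < i") auto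
    thus ?thesis using entry[of i j] that by simp
  qed
  moreover have "(?C * B) $$ (i, i) = B $$ (i, i) ^ Suc k" if "i < n" for i
  proof -
    have "?C $$ (i, l) * B $$ (l, i) = (if l = i then B $$ (i, i) ^ Suc k else 0)" if "l < n" for l
      using lo[of l i] loB[of i l] \<open>i < n\<close> that Suc by (cases l i rule: linorder_cases) (auto simp: mult.commute)
    hence "(?C * B) $$ (i, i) = (\<Sum>l<n. if l = i then B $$ (i, i) ^ Suc k else 0)"
      unfolding entry[OF that that] by (intro sum.cong) auto
    thus ?thesis using that by simp
  qed
  ultimately show ?case using B C by (auto intro!: upper_triangularI)
qed

text \<open>Schur triangularization; \<open>e\<close> is the diagonal of the triangular form. The
  second conclusion hands relations between powers of \<open>A\<close> down to its eigenvalues,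
  which is how idempotency and finite order are exploited.\<close>

lemma mat_trace_pow_eigenvalues:
  fixes A :: "complex mat"
  assumes A: "A \<in> carrier_mat n n"
  obtains e where "\<And>k. mat_trace (A ^\<^sub>m k) = (\<Sum>i<n. e i ^ k)"
    and "\<And>k l i. A ^\<^sub>m k = A ^\<^sub>m l \<Longrightarrow> i < n \<Longrightarrow> e i ^ k = e i ^ l"
proof -
  from char_poly_factorized[OF A] obtain es where "char_poly A = (\<Prod>a\<leftarrow>es. [:- a, 1:])" by blast
  from schur_decomposition_exists[OF A this] obtain B P Q
    where B: "B \<in> carrier_mat n n" "upper_triangular B" and w: "similar_mat_wit A B P Q"
    unfolding similar_mat_def by blast
  note up = upper_triangular_pow[OF B]
  have wk: "similar_mat_wit (A ^\<^sub>m k) (B ^\<^sub>m k) P Q" for k by (rule similar_mat_wit_pow[OF w])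
  have Ak: "A ^\<^sub>m k \<in> carrier_mat n n" "B ^\<^sub>m k \<in> carrier_mat n n" for k using A B by (auto simp: pow_carrier_mat)
  show thesis
  proof (rule that[of "\<lambda>i. B $$ (i, i)"])
    fix k
    have "mat_trace (A ^\<^sub>m k) = mat_trace (B ^\<^sub>m k)" by (rule mat_trace_similar[OF Ak(1) wk])
    thus "mat_trace (A ^\<^sub>m k) = (\<Sum>i<n. B $$ (i, i) ^ k)"
      using up[of k] Ak[of k] B by (auto simp: mat_trace_def intro!: sum.cong)
  next
    fix k l i assume eq: "A ^\<^sub>m k = A ^\<^sub>m l" and i: "i < n"
    have "B ^\<^sub>m k = Q * A ^\<^sub>m k * P" for k
      by (rule similar_mat_witD2(3)[OF Ak(2) similar_mat_wit_sym[OF wk]])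
    hence "B ^\<^sub>m k = B ^\<^sub>m l" using eq by simp
    thus "B $$ (i, i) ^ k = B $$ (i, i) ^ l" using up i by metis
  qed
qed

text \<open>All eigenvalues are 0 or 1, so the trace counts the eigenvalues equal to 1.\<close>

lemma mat_trace_idempotent:
  assumes A: "A \<in> carrier_mat n n" and id: "A * A = A"
  shows "mat_trace A \<in> \<int>"
proof -
  from mat_trace_pow_eigenvalues[OF A] obtain e where
    tr: "\<And>k. mat_trace (A ^\<^sub>m k) = (\<Sum>i<n. e i ^ k)"
    and eq: "\<And>k l i. A ^\<^sub>m k = A ^\<^sub>m l \<Longrightarrow> i < n \<Longrightarrow> e i ^ k = e i ^ l" by blast
  have p1: "A ^\<^sub>m 1 = A" using A by simp
  have p2: "A ^\<^sub>m 2 = A" using A id by (simp add: numeral_2_eq_2)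
  have "e i \<in> \<int>" if "i < n" for i
  proof -
    have "e i ^ 2 = e i" using eq[of 2 1 i] p1 p2 that by simp
    hence "e i = 0 \<or> e i = 1" by (simp add: power2_eq_square)
    thus ?thesis by auto
  qed
  hence "(\<Sum>i<n. e i ^ 1) \<in> \<int>" by (intro Ints_sum) auto
  thus ?thesis using tr[of 1] p1 by simp
qed

section \<open>Cyclotomic integers\<close>

text \<open>For positive \<open>N\<close> this is the ring Z[zeta] with zeta a primitive
  \<open>N\<close>-th root of unity. It is presented as a Z-span with possibly non-unique
  coefficients; exponents below \<open>N\<close> suffice since zeta^N = 1.\<close>

definition cyclotomic_ints :: "nat \<Rightarrow> complex set" where
  "cyclotomic_ints N = {z. \<exists>a :: nat \<Rightarrow> int. z = (\<Sum>k<N. of_int (a k) * cis (2 * pi / N) ^ k)}"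

lemma cyclotomic_ints_sum:
  assumes "\<And>x. x \<in> A \<Longrightarrow> f x \<in> cyclotomic_ints N"
  shows "(\<Sum>x\<in>A. of_int (c x) * f x) \<in> cyclotomic_ints N"
proof -
  from assms have "\<forall>x\<in>A. \<exists>a :: nat \<Rightarrow> int. f x = (\<Sum>k<N. of_int (a k) * cis (2 * pi / N) ^ k)"
    unfolding cyclotomic_ints_def by blast
  then obtain a :: "_ \<Rightarrow> nat \<Rightarrow> int"
    where a: "\<And>x. x \<in> A \<Longrightarrow> f x = (\<Sum>k<N. of_int (a x k) * cis (2 * pi / N) ^ k)" by metis
  have "(\<Sum>x\<in>A. of_int (c x) * f x)
      = (\<Sum>x\<in>A. \<Sum>k<N. of_int (c x * a x k) * cis (2 * pi / N) ^ k)"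
    by (intro sum.cong refl) (simp add: a sum_distrib_left mult.assoc)
  also have "\<dots> = (\<Sum>k<N. of_int (\<Sum>x\<in>A. c x * a x k) * cis (2 * pi / N) ^ k)"
    by (subst sum.swap) (simp add: sum_distrib_right)
  finally show ?thesis unfolding cyclotomic_ints_def by (intro CollectI exI)
qed

lemma root_of_unity_in_cyclotomic_ints:
  assumes "N > 0" "z ^ N = 1"
  shows "z \<in> cyclotomic_ints N"
proof -
  have "z \<in> (\<lambda>k. cis (2 * pi * real k / real N)) ` {..<N}"
    using bij_betw_roots_unity[OF assms(1)] assms(2) unfolding bij_betw_def by auto
  then obtain k where k: "k < N" "z = cis (2 * pi * real k / real N)" by auto
  hence "z = cis (2 * pi / N) ^ k" by (simp add: DeMoivre mult_ac)
  also have "\<dots> = (\<Sum>j<N. of_int (if j = k then 1 else 0) * cis (2 * pi / N) ^ j)"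
    using k(1) by (subst sum.remove[of _ k]) auto
  finally show ?thesis unfolding cyclotomic_ints_def
    by (intro CollectI exI[of _ "\<lambda>j. if j = k then 1 else 0"])
qed

text \<open>Multiplication by such a number is an integer matrix in the generators, so the number
  is a root of a characteristic polynomial with integer coefficients.\<close>

lemma cyclotomic_ints_algebraic_int:
  assumes N: "N > 0" and z: "z \<in> cyclotomic_ints N"
  shows "algebraic_int z"
proof -
  let ?w = "cis (2 * pi / N)"
  have wN: "?w ^ N = 1" using N by (simp add: DeMoivre)
  have "z * ?w ^ i \<in> cyclotomic_ints N" for i
  proof -
    from z obtain a :: "nat \<Rightarrow> int" where "z = (\<Sum>k<N. of_int (a k) * ?w ^ k)"
      unfolding cyclotomic_ints_def by blast
    hence "z * ?w ^ i = (\<Sum>k<N. of_int (a k) * ?w ^ (k + i))"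
      by (simp add: sum_distrib_right power_add mult.assoc)
    \<comment> \<open>The exponent \<open>k + i\<close> may exceed the range of the spanning set,
      but the power is still an \<open>N\<close>-th root of unity.\<close>
    moreover have "?w ^ (k + i) \<in> cyclotomic_ints N" for k
    proof (rule root_of_unity_in_cyclotomic_ints[OF N])
      have "(?w ^ (k + i)) ^ N = (?w ^ N) ^ (k + i)" unfolding power_mult[symmetric] by (simp add: mult.commute)
      thus "(?w ^ (k + i)) ^ N = 1" by (simp add: wN)
    qed
    ultimately show ?thesis using cyclotomic_ints_sum[of "{..<N}"] by simp
  qed
  hence "\<forall>i. \<exists>a :: nat \<Rightarrow> int. z * ?w ^ i = (\<Sum>k<N. of_int (a k) * ?w ^ k)"
    unfolding cyclotomic_ints_def by blast
  then obtain M :: "nat \<Rightarrow> nat \<Rightarrow> int" where M: "\<And>i. z * ?w ^ i = (\<Sum>k<N. of_int (M i k) * ?w ^ k)"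
    by metis
  \<comment> \<open>Row \<open>i\<close> of \<open>A\<close> holds the coefficients of z * w^i, so
    \<open>v\<close> is an eigenvector of \<open>A\<close> for \<open>z\<close>. It is nonzero
    because its entry at 0 is 1.\<close>
  define A where "A = mat N N (\<lambda>(i, k). M i k)"
  define v where "v = vec N (\<lambda>k. ?w ^ k)"
  have A: "A \<in> carrier_mat N N" and A': "map_mat complex_of_int A \<in> carrier_mat N N"
    and v: "v \<in> carrier_vec N" by (auto simp: A_def v_def)
  have "v \<noteq> 0\<^sub>v N" using N by (auto simp: v_def vec_eq_iff)
  moreover have "map_mat complex_of_int A *\<^sub>v v = z \<cdot>\<^sub>v v"
    by (rule eq_vecI) (auto simp: A_def v_def scalar_prod_def M atLeast0LessThan)
  ultimately have "eigenvalue (map_mat complex_of_int A) z"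
    unfolding eigenvalue_def eigenvector_def using A' v by (intro exI[of _ v]) auto
  hence "poly (char_poly (map_mat complex_of_int A)) z = 0" using eigenvalue_root_char_poly[OF A'] by simp
  hence "poly (map_poly complex_of_int (char_poly A)) z = 0" by (simp add: of_int_hom.char_poly_hom[OF A])
  moreover have "lead_coeff (char_poly A) = 1" using degree_monic_char_poly[OF A] by simp
  ultimately show ?thesis unfolding algebraic_int_altdef_ipoly by blast
qed

lemma cyclotomic_ints_rational:
  assumes "N > 0" "z \<in> cyclotomic_ints N" "z \<in> \<rat>"
  shows "z \<in> \<int>"
  using rational_algebraic_int_is_int cyclotomic_ints_algebraic_int assms by blast

section \<open>Kronecker products\<close>

definition kron_mat :: "complex mat \<Rightarrow> complex mat \<Rightarrow> complex mat" where
  "kron_mat A B = mat (dim_row A * dim_row B) (dim_col A * dim_col B)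
     (\<lambda>(i, j). A $$ (i div dim_row B, j div dim_col B) * B $$ (i mod dim_row B, j mod dim_col B))"

lemma kron_mat_carrier:
  "A \<in> carrier_mat m n \<Longrightarrow> B \<in> carrier_mat r s \<Longrightarrow> kron_mat A B \<in> carrier_mat (m * r) (n * s)"
  by (simp add: kron_mat_def)

text \<open>The substitution i = a * n + b inverts the div/mod coding of index pairs in
  \<open>kron_mat\<close> and turns a sum over a Kronecker index into a double sum.\<close>

lemma sum_lessThan_mult:
  fixes f :: "nat \<Rightarrow> 'a :: comm_monoid_add"
  shows "(\<Sum>i<m * n. f i) = (\<Sum>a<m. \<Sum>b<n. f (a * n + b))"
proof -
  have "(\<Sum>i = a * n..<a * n + n. f i) = (\<Sum>b<n. f (a * n + b))" for a
    using sum.shift_bounds_nat_ivl[of f 0 "a * n" n] by (simp add: atLeast0LessThan add.commute)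
  thus ?thesis by (simp add: sum.nat_group[symmetric])
qed

lemma mult_add_less_mult:
  fixes a b m n :: nat
  assumes "a < m" "b < n"
  shows "a * n + b < m * n"
proof -
  have "a * n + b < Suc a * n" using assms by simp
  also have "\<dots> \<le> m * n" using assms by (intro mult_right_mono) auto
  finally show ?thesis .
qed

lemma kron_mat_mult:
  assumes "A \<in> carrier_mat m m" "C \<in> carrier_mat m m" "B \<in> carrier_mat n n" "D \<in> carrier_mat n n"
  shows "kron_mat (A * C) (B * D) = kron_mat A B * kron_mat C D"
proof (rule eq_matI)
  fix i j assume "i < dim_row (kron_mat A B * kron_mat C D)" "j < dim_col (kron_mat A B * kron_mat C D)"
  hence ij: "i < m * n" "j < m * n" using assms by (auto simp: kron_mat_def)
  hence n: "n > 0" by (cases n) auto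
  have q: "i div n < m" "j div n < m" "i mod n < n" "j mod n < n"
    using ij n by (auto simp: less_mult_imp_div_less)
  have "(kron_mat A B * kron_mat C D) $$ (i, j)
      = (\<Sum>l<m * n. kron_mat A B $$ (i, l) * kron_mat C D $$ (l, j))"
    using ij assms kron_mat_carrier[OF assms(1,3)] kron_mat_carrier[OF assms(2,4)]
    by (auto simp: scalar_prod_def atLeast0LessThan)
  also have "\<dots> = (\<Sum>a<m. \<Sum>b<n. (A $$ (i div n, a) * B $$ (i mod n, b)) * (C $$ (a, j div n) * D $$ (b, j mod n)))"
    unfolding sum_lessThan_mult
    by (intro sum.cong refl) (use assms ij mult_add_less_mult n in \<open>auto simp: kron_mat_def\<close>)
  also have "\<dots> = (\<Sum>a<m. A $$ (i div n, a) * C $$ (a, j div n)) * (\<Sum>b<n. B $$ (i mod n, b) * D $$ (b, j mod n))"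
    by (simp add: sum_product mult_ac)
  also have "\<dots> = kron_mat (A * C) (B * D) $$ (i, j)"
    using assms ij q by (auto simp: kron_mat_def scalar_prod_def atLeast0LessThan)
  finally show "kron_mat (A * C) (B * D) $$ (i, j) = (kron_mat A B * kron_mat C D) $$ (i, j)" ..
qed (use assms in \<open>auto simp: kron_mat_def\<close>)

lemma kron_mat_one: "kron_mat (1\<^sub>m m) (1\<^sub>m n) = 1\<^sub>m (m * n)"
proof (rule eq_matI)
  fix i j assume "i < dim_row (1\<^sub>m (m * n))" "j < dim_col (1\<^sub>m (m * n))"
  hence ij: "i < m * n" "j < m * n" by auto
  hence n: "n > 0" by (cases n) auto
  have q: "i div n < m" "j div n < m" "i mod n < n" "j mod n < n"
    using ij n by (auto simp: less_mult_imp_div_less)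
  have "i = j" if "i div n = j div n" "i mod n = j mod n"
    using that by (metis div_mult_mod_eq)
  thus "kron_mat (1\<^sub>m m) (1\<^sub>m n) $$ (i, j) = 1\<^sub>m (m * n) $$ (i, j)"
    using ij q by (auto simp: kron_mat_def)
qed (auto simp: kron_mat_def)

lemma mat_trace_kron_mat:
  assumes "A \<in> carrier_mat m m" "B \<in> carrier_mat n n"
  shows "mat_trace (kron_mat A B) = mat_trace A * mat_trace B"
proof -
  have "mat_trace (kron_mat A B) = (\<Sum>a<m. \<Sum>b<n. A $$ (a, a) * B $$ (b, b))"
    unfolding mat_trace_def using assms kron_mat_carrier[OF assms] mult_add_less_mult
    by (auto simp: sum_lessThan_mult kron_mat_def intro!: sum.cong)
  thus ?thesis using assms by (simp add: mat_trace_def sum_product)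
qed

section \<open>Representations and their traces\<close>

locale finite_grp = group G for G (structure) +
  assumes fin: "finite (carrier G)"
begin

section \<open>Reindexing sums over the group; matrices of finite order\<close>

abbreviation "gorder \<equiv> card (carrier G)"

lemma gorder_pos: "gorder > 0"
  using fin one_closed by (auto simp: card_gt_0_iff)

lemma sum_left_translate:
  assumes "a \<in> carrier G"
  shows "(\<Sum>g\<in>carrier G. f (a \<otimes> g)) = (\<Sum>g\<in>carrier G. f g)"
  using assms
  by (intro sum.reindex_bij_witness[of _ "\<lambda>g. inv a \<otimes> g" "\<lambda>g. a \<otimes> g"]) (auto simp: m_assoc[symmetric])

lemma sum_right_translate:
  assumes "a \<in> carrier G"
  shows "(\<Sum>g\<in>carrier G. f (g \<otimes> a)) = (\<Sum>g\<in>carrier G. f g)"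
  using assms
  by (intro sum.reindex_bij_witness[of _ "\<lambda>g. g \<otimes> inv a" "\<lambda>g. g \<otimes> a"]) (auto simp: m_assoc)

lemma sum_inv: "(\<Sum>g\<in>carrier G. f (inv g)) = (\<Sum>g\<in>carrier G. f g)"
  by (intro sum.reindex_bij_witness[of _ "\<lambda>g. inv g" "\<lambda>g. inv g"]) auto

lemma sum_conjugate:
  assumes "a \<in> carrier G"
  shows "(\<Sum>g\<in>carrier G. f (a \<otimes> g \<otimes> inv a)) = (\<Sum>g\<in>carrier G. f g)"
  using sum_right_translate[of "inv a" "\<lambda>g. f g"] sum_left_translate[of a "\<lambda>g. f (g \<otimes> inv a)"] assms
  by simp

lemma rep_carrier: "is_rep G d \<rho> \<Longrightarrow> g \<in> carrier G \<Longrightarrow> \<rho> g \<in> carrier_mat d d"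
  and rep_one: "is_rep G d \<rho> \<Longrightarrow> \<rho> \<one> = 1\<^sub>m d"
  and rep_mult: "is_rep G d \<rho> \<Longrightarrow> g \<in> carrier G \<Longrightarrow> h \<in> carrier G \<Longrightarrow> \<rho> (g \<otimes> h) = \<rho> g * \<rho> h"
  by (auto simp: is_rep_def)

lemma rep_entry_mult:
  assumes "is_rep G d \<rho>" "g \<in> carrier G" "h \<in> carrier G" "i < d" "j < d"
  shows "\<rho> (g \<otimes> h) $$ (i, j) = (\<Sum>k<d. \<rho> g $$ (i, k) * \<rho> h $$ (k, j))"
  using assms(4,5) rep_carrier[OF assms(1,2)] rep_carrier[OF assms(1,3)]
  by (simp add: rep_mult[OF assms(1-3)] scalar_prod_def atLeast0LessThan)

lemma rep_pow:
  assumes "is_rep G d \<rho>" "g \<in> carrier G"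
  shows "\<rho> (g [^] (k::nat)) = \<rho> g ^\<^sub>m k"
  by (induction k) (use assms rep_carrier[OF assms] in \<open>auto simp: rep_one rep_mult\<close>)

lemma rep_pow_gorder:
  assumes "is_rep G d \<rho>" "g \<in> carrier G"
  shows "\<rho> g ^\<^sub>m gorder = 1\<^sub>m d"
  using rep_pow[OF assms, of gorder] pow_order_eq_1[OF assms(2)] rep_one[OF assms(1)]
  by (simp add: Coset.order_def)

text \<open>Since g^|G| = 1, the eigenvalues of \<open>\<rho> g\<close> are roots of unity, whose
  inverses are their conjugates. Writing \<open>inv g\<close> as the power of \<open>g\<close> with
  exponent \<open>gorder - 1\<close> lets the same eigenvalues \<open>e\<close> compute the trace at
  the inverse.\<close>

lemma rep_trace_cyclotomic:
  assumes "is_rep G d \<rho>" "g \<in> carrier G"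
  shows "mat_trace (\<rho> g) \<in> cyclotomic_ints gorder"
    and "mat_trace (\<rho> (inv g)) = cnj (mat_trace (\<rho> g))"
proof -
  note c = rep_carrier[OF assms]
  from mat_trace_pow_eigenvalues[OF c] obtain e where
    tr: "\<And>k. mat_trace (\<rho> g ^\<^sub>m k) = (\<Sum>i<d. e i ^ k)"
    and eq: "\<And>k l i. \<rho> g ^\<^sub>m k = \<rho> g ^\<^sub>m l \<Longrightarrow> i < d \<Longrightarrow> e i ^ k = e i ^ l" by blast
  have t1: "mat_trace (\<rho> g) = (\<Sum>i<d. e i)" using tr[of 1] c by simp
  have root: "e i ^ gorder = 1" if "i < d" for i
    using eq[of gorder 0 i] that rep_pow_gorder[OF assms] c by simp
  hence "e i \<in> cyclotomic_ints gorder" if "i < d" for i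
    using root_of_unity_in_cyclotomic_ints gorder_pos that by blast
  thus "mat_trace (\<rho> g) \<in> cyclotomic_ints gorder"
    using cyclotomic_ints_sum[of "{..<d}" e gorder "\<lambda>_. 1"] t1 by simp
  have "g [^] Suc (gorder - 1) = \<one>"
    using pow_order_eq_1[OF assms(2)] gorder_pos by (simp add: Coset.order_def del: nat_pow_Suc)
  hence "g [^] (gorder - 1) \<otimes> g = \<one>" by simp
  hence "inv g = g [^] (gorder - 1)" using assms(2) by (intro inv_equality) auto
  hence "mat_trace (\<rho> (inv g)) = (\<Sum>i<d. e i ^ (gorder - 1))"
    using rep_pow[OF assms] tr by simp
  also have "\<dots> = (\<Sum>i<d. cnj (e i))"
  proof (intro sum.cong refl)
    fix i assume "i \<in> {..<d}"
    hence r: "e i ^ gorder = 1" using root by simp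
    have "norm (e i) = 1" using power_eq_1_iff[OF r] gorder_pos by simp
    hence "e i * cnj (e i) = 1" by (simp add: complex_norm_square[symmetric])
    moreover have "e i * e i ^ (gorder - 1) = 1" using r gorder_pos by (simp add: power_eq_if)
    ultimately show "e i ^ (gorder - 1) = cnj (e i)"
      by (metis mult_cancel_left zero_neq_one mult_zero_left)
  qed
  finally show "mat_trace (\<rho> (inv g)) = cnj (mat_trace (\<rho> g))" using t1 by simp
qed

text \<open>The average of a representation is idempotent (the projection onto the fixed vectors).\<close>

lemma rep_average_trace_Ints:
  assumes r: "is_rep G d \<rho>"
  shows "(\<Sum>g\<in>carrier G. mat_trace (\<rho> g)) / of_nat gorder \<in> \<int>"
proof -
  let ?N = "of_nat gorder :: complex"
  have N: "?N \<noteq> 0" using gorder_pos by simp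
  define S where "S = (\<lambda>i j. \<Sum>g\<in>carrier G. \<rho> g $$ (i, j))"
  define E where "E = mat d d (\<lambda>(i, j). S i j / ?N)"
  have E: "E \<in> carrier_mat d d" by (simp add: E_def)
  \<comment> \<open>The matrix \<open>S\<close> is the sum of all \<open>\<rho> g\<close>.
    Multiplying by one \<open>\<rho> g\<close> only permutes its summands, so its square is |G|
    times itself.\<close>
  have SS: "(\<Sum>k<d. S i k * S k j) = ?N * S i j" if "i < d" "j < d" for i j
  proof -
    have "(\<Sum>k<d. S i k * S k j) = (\<Sum>k<d. \<Sum>g\<in>carrier G. \<Sum>h\<in>carrier G. \<rho> g $$ (i, k) * \<rho> h $$ (k, j))"
      by (simp add: S_def sum_product)
    also have "\<dots> = (\<Sum>g\<in>carrier G. \<Sum>h\<in>carrier G. \<Sum>k<d. \<rho> g $$ (i, k) * \<rho> h $$ (k, j))"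
      by (subst sum.swap) (intro sum.cong refl sum.swap)
    also have "\<dots> = (\<Sum>g\<in>carrier G. \<Sum>h\<in>carrier G. \<rho> (g \<otimes> h) $$ (i, j))"
      by (intro sum.cong refl) (use rep_entry_mult[OF r] that in simp)
    also have "\<dots> = (\<Sum>g\<in>carrier G. S i j)"
      unfolding S_def by (rule sum.cong[OF refl], rule sum_left_translate)
    finally show ?thesis by simp
  qed
  have "E * E = E"
  proof (rule eq_matI)
    fix i j assume "i < dim_row E" "j < dim_col E"
    hence ij: "i < d" "j < d" using E by auto
    hence "(E * E) $$ (i, j) = (\<Sum>k<d. S i k * S k j) / (?N * ?N)"
      by (simp add: E_def scalar_prod_def atLeast0LessThan sum_divide_distrib)
    thus "(E * E) $$ (i, j) = E $$ (i, j)" using SS[OF ij] N ij by (simp add: E_def)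
  qed (use E in auto)
  hence "mat_trace E \<in> \<int>" by (rule mat_trace_idempotent[OF E])
  moreover have "mat_trace E = (\<Sum>g\<in>carrier G. mat_trace (\<rho> g)) / ?N"
  proof -
    have "(\<Sum>g\<in>carrier G. mat_trace (\<rho> g)) = (\<Sum>g\<in>carrier G. \<Sum>i<d. \<rho> g $$ (i, i))"
      unfolding mat_trace_def by (intro sum.cong refl) (use rep_carrier[OF r] in auto)
    also have "\<dots> = (\<Sum>i<d. S i i)" unfolding S_def by (rule sum.swap)
    finally show ?thesis by (simp add: mat_trace_def E_def sum_divide_distrib)
  qed
  ultimately show ?thesis by simp
qed

section \<open>Characters: products, conjugates and integrality of inner products\<close>

definition is_char :: "('a \<Rightarrow> complex) \<Rightarrow> bool" where
  "is_char f \<longleftrightarrow> (\<exists>d \<rho>. is_rep G d \<rho> \<and> (\<forall>g\<in>carrier G. f g = mat_trace (\<rho> g)))"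

text \<open>Afforded by the tensor product, realized as the Kronecker product of matrices.\<close>

lemma is_char_mult:
  assumes "is_char f" "is_char f'"
  shows "is_char (\<lambda>g. f g * f' g)"
proof -
  from assms obtain d \<rho> d' \<rho>' where r: "is_rep G d \<rho>" "\<forall>g\<in>carrier G. f g = mat_trace (\<rho> g)"
    "is_rep G d' \<rho>'" "\<forall>g\<in>carrier G. f' g = mat_trace (\<rho>' g)" unfolding is_char_def by blast
  note c = rep_carrier[OF r(1)] rep_carrier[OF r(3)]
  have "is_rep G (d * d') (\<lambda>g. kron_mat (\<rho> g) (\<rho>' g))"
    unfolding is_rep_def using c
    by (auto simp: rep_one[OF r(1)] rep_one[OF r(3)] kron_mat_one rep_mult[OF r(1)] rep_mult[OF r(3)]
      intro!: kron_mat_carrier kron_mat_mult)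
  moreover have "f g * f' g = mat_trace (kron_mat (\<rho> g) (\<rho>' g))" if "g \<in> carrier G" for g
    using r(2,4) that by (simp add: mat_trace_kron_mat[OF c[OF that]])
  ultimately show ?thesis unfolding is_char_def by blast
qed

lemma is_char_cnj:
  assumes "is_char f"
  shows "is_char (\<lambda>g. cnj (f g))"
proof -
  from assms obtain d \<rho> where r: "is_rep G d \<rho>" "\<forall>g\<in>carrier G. f g = mat_trace (\<rho> g)"
    unfolding is_char_def by blast
  note c = rep_carrier[OF r(1)]
  have "is_rep G d (\<lambda>g. map_mat cnj (\<rho> g))"
    unfolding is_rep_def
  proof (intro conjI ballI)
    show "map_mat cnj (\<rho> \<one>) = 1\<^sub>m d" by (rule eq_matI) (auto simp: rep_one[OF r(1)])
    fix g h assume gh: "g \<in> carrier G" "h \<in> carrier G"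
    show "map_mat cnj (\<rho> (g \<otimes> h)) = map_mat cnj (\<rho> g) * map_mat cnj (\<rho> h)"
      by (rule eq_matI) (use gh c[OF gh(1)] c[OF gh(2)] in
        \<open>auto simp: rep_mult[OF r(1)] scalar_prod_def\<close>)
  qed (use c in auto)
  moreover have "cnj (f g) = mat_trace (map_mat cnj (\<rho> g))" if "g \<in> carrier G" for g
    using r(2) c[OF that] that by (auto simp: mat_trace_def)
  ultimately show ?thesis unfolding is_char_def by blast
qed

text \<open>The trivial character. \<open>is_char\<close> compares values on the carrier only, so
  the constant function qualifies although \<open>character\<close> is 0 off the group.\<close>

lemma is_char_one: "is_char (\<lambda>_. 1)"
  unfolding is_char_def
  by (intro exI[of _ 1] exI[of _ "\<lambda>_. 1\<^sub>m 1"]) (auto simp: is_rep_def mat_trace_def)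

lemma is_char_prod:
  assumes "finite I" "\<And>i. i \<in> I \<Longrightarrow> is_char (f i)"
  shows "is_char (\<lambda>g. \<Prod>i\<in>I. f i g)"
  using assms by (induction I rule: finite_induct) (auto intro: is_char_one is_char_mult)

lemma is_char_Irr:
  assumes "\<chi> \<in> Irr G"
  shows "is_char \<chi>"
proof -
  from assms obtain d \<rho> where "is_rep G d \<rho>" "\<chi> = character G \<rho>"
    unfolding Irr_def is_irr_rep_def by blast
  thus ?thesis unfolding is_char_def by (intro exI[of _ d] exI[of _ \<rho>]) (simp add: character_def)
qed

text \<open>The product of \<open>f\<close> with the conjugate of \<open>h\<close> is again a
  character, and the inner product is the average of its values, i.e. the trace of the averaging
  projection.\<close>

lemma cf_inner_Ints:
  assumes "is_char f" "is_char h"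
  shows "cf_inner G f h \<in> \<int>"
proof -
  from is_char_mult[OF assms(1) is_char_cnj[OF assms(2)]] obtain d \<rho>
    where r: "is_rep G d \<rho>" "\<forall>g\<in>carrier G. f g * cnj (h g) = mat_trace (\<rho> g)"
    unfolding is_char_def by blast
  show ?thesis using rep_average_trace_Ints[OF r(1)] r(2) by (simp add: cf_inner_def cong: sum.cong)
qed

lemma is_char_cyclotomic:
  assumes "is_char f" "g \<in> carrier G"
  shows "f g \<in> cyclotomic_ints gorder" "f (inv g) = cnj (f g)"
  using assms rep_trace_cyclotomic unfolding is_char_def by auto

end

section \<open>Schur's lemma and orthonormality of irreducible characters\<close>

lemma mult_mat_unit_vec:
  fixes A :: "complex mat"
  assumes A: "A \<in> carrier_mat m n" and j: "j < n"
  shows "A *\<^sub>v unit_vec n j = col A j"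
proof (rule eq_vecI)
  fix i assume "i < dim_vec (col A j)"
  hence "i < m" using A by simp
  thus "(A *\<^sub>v unit_vec n j) $ i = col A j $ i"
    using A j scalar_prod_right_unit[OF j, of "row A i"] by simp
qed (use A in simp)

lemma eq_mat_mult_vecI:
  assumes "A \<in> carrier_mat m n" "B \<in> carrier_mat m n"
    and "\<And>v. v \<in> carrier_vec n \<Longrightarrow> A *\<^sub>v v = B *\<^sub>v (v :: complex vec)"
  shows "A = B"
proof (rule mat_col_eqI)
  fix j assume "j < dim_col B"
  hence "j < n" using assms(2) by simp
  thus "col A j = col B j"
    using mult_mat_unit_vec[OF assms(1)] mult_mat_unit_vec[OF assms(2)] assms(3)[of "unit_vec n j"] by simp
qed (use assms in auto)

lemma smult_one_mult_vec: "v \<in> carrier_vec n \<Longrightarrow> (c \<cdot>\<^sub>m 1\<^sub>m n) *\<^sub>v v = c \<cdot>\<^sub>v (v :: complex vec)"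
  by (intro eq_vecI) (auto simp: scalar_prod_def if_distrib if_distribR sum.delta cong: if_cong)

context finite_grp
begin

lemma irr_rep_subspace:
  assumes "is_irr_rep G d \<rho>" "is_subspace d W"
    and "\<And>g w. g \<in> carrier G \<Longrightarrow> w \<in> W \<Longrightarrow> \<rho> g *\<^sub>v w \<in> W"
  shows "W = {0\<^sub>v d} \<or> W = carrier_vec d"
proof -
  have "is_subspace d W \<and> (\<forall>g\<in>carrier G. \<forall>w\<in>W. \<rho> g *\<^sub>v w \<in> W)" using assms(2,3) by simp
  thus ?thesis using assms(1) unfolding is_irr_rep_def by simp
qed

lemma irr_rep_is_rep: "is_irr_rep G d \<rho> \<Longrightarrow> is_rep G d \<rho>"
  by (simp add: is_irr_rep_def)

lemma irr_rep_dim_pos: "is_irr_rep G d \<rho> \<Longrightarrow> d > 0"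
  by (simp add: is_irr_rep_def)

text \<open>The first half of Schur's lemma: kernel and image of \<open>T\<close> are invariant
  subspaces, so a nonzero \<open>T\<close> is bijective, and conjugation by it preserves traces. The
  degrees \<open>d\<close> and \<open>e\<close> may differ a priori, so a two-sided inverse is
  constructed by hand.\<close>

lemma intertwiner_trace_eq:
  assumes irr: "is_irr_rep G d \<rho>" "is_irr_rep G e \<sigma>"
    and T: "T \<in> carrier_mat d e" "T \<noteq> 0\<^sub>m d e"
    and comm: "\<And>g. g \<in> carrier G \<Longrightarrow> \<rho> g * T = T * \<sigma> g"
    and g: "g \<in> carrier G"
  shows "mat_trace (\<rho> g) = mat_trace (\<sigma> g)"
proof -
  note r = rep_carrier[OF irr_rep_is_rep[OF irr(1)]] and s = rep_carrier[OF irr_rep_is_rep[OF irr(2)]]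
  have T0: False if "\<And>v. v \<in> carrier_vec e \<Longrightarrow> T *\<^sub>v v = 0\<^sub>v d"
  proof -
    have "0\<^sub>m d e *\<^sub>v v = 0\<^sub>v d" if "v \<in> carrier_vec e" for v :: "complex vec"
      using that by (intro eq_vecI) auto
    hence "T = 0\<^sub>m d e" using that by (intro eq_mat_mult_vecI[OF T(1)]) auto
    thus False using T(2) by simp
  qed
  have commv: "\<rho> g *\<^sub>v (T *\<^sub>v v) = T *\<^sub>v (\<sigma> g *\<^sub>v v)" if "g \<in> carrier G" "v \<in> carrier_vec e" for g v
    using assoc_mult_mat_vec[OF r[OF that(1)] T(1) that(2)] assoc_mult_mat_vec[OF T(1) s[OF that(1)] that(2)]
      comm[OF that(1)] by simp
  let ?K = "{v \<in> carrier_vec e. T *\<^sub>v v = 0\<^sub>v d}"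
  have "?K = {0\<^sub>v e} \<or> ?K = carrier_vec e"
  proof (rule irr_rep_subspace[OF irr(2)])
    have "T *\<^sub>v 0\<^sub>v e = 0\<^sub>v d" using T(1) by (intro eq_vecI) auto
    moreover have "T *\<^sub>v (v + w) = 0\<^sub>v d" if "v \<in> ?K" "w \<in> ?K" for v w
      using that T(1) by (simp add: mult_add_distrib_mat_vec)
    moreover have "T *\<^sub>v (b \<cdot>\<^sub>v v) = 0\<^sub>v d" if "v \<in> ?K" for b v
      using that T(1) by (auto simp: mult_mat_vec intro!: eq_vecI)
    ultimately show "is_subspace e ?K" unfolding is_subspace_def by auto
  next
    fix g w assume g: "g \<in> carrier G" "w \<in> ?K"
    have "\<rho> g *\<^sub>v 0\<^sub>v d = 0\<^sub>v d" using r[OF g(1)] by (intro eq_vecI) auto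
    thus "\<sigma> g *\<^sub>v w \<in> ?K" using commv[of g w] g s[OF g(1)] by auto
  qed
  hence inj: "v = 0\<^sub>v e" if "v \<in> carrier_vec e" "T *\<^sub>v v = 0\<^sub>v d" for v
    using T0 that by blast
  let ?I = "(\<lambda>v. T *\<^sub>v v) ` carrier_vec e"
  have "?I = {0\<^sub>v d} \<or> ?I = carrier_vec d"
  proof (rule irr_rep_subspace[OF irr(1)])
    show "is_subspace d ?I" unfolding is_subspace_def
    proof (intro conjI ballI allI)
      show "?I \<subseteq> carrier_vec d" using T(1) by auto
      show "0\<^sub>v d \<in> ?I" using T(1) by (intro image_eqI[of _ _ "0\<^sub>v e"]) (auto intro!: eq_vecI)
    next
      fix v w assume "v \<in> ?I" "w \<in> ?I"
      then obtain v' w' where "v = T *\<^sub>v v'" "w = T *\<^sub>v w'" "v' \<in> carrier_vec e" "w' \<in> carrier_vec e" by blast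
      thus "v + w \<in> ?I" using T(1) by (intro image_eqI[of _ _ "v' + w'"]) (auto simp: mult_add_distrib_mat_vec)
    next
      fix c v assume "v \<in> ?I"
      then obtain v' where "v = T *\<^sub>v v'" "v' \<in> carrier_vec e" by blast
      thus "c \<cdot>\<^sub>v v \<in> ?I" using T(1) by (intro image_eqI[of _ _ "c \<cdot>\<^sub>v v'"]) (auto simp: mult_mat_vec)
    qed
  next
    fix g w assume g: "g \<in> carrier G" "w \<in> ?I"
    thus "\<rho> g *\<^sub>v w \<in> ?I" using commv s[OF g(1)] by auto
  qed
  hence "?I = carrier_vec d" using T0 by blast
  hence "\<forall>i. \<exists>v \<in> carrier_vec e. T *\<^sub>v v = unit_vec d i" by (metis (no_types) image_iff unit_vec_carrier)
  then obtain u where u: "\<And>i. u i \<in> carrier_vec e" "\<And>i. T *\<^sub>v u i = unit_vec d i" by metis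
  \<comment> \<open>The columns of \<open>S\<close> are preimages of the unit vectors under
    \<open>T\<close>, which makes \<open>S\<close> a right inverse.\<close>
  define S where "S = mat e d (\<lambda>(i, j). u j $ i)"
  have S: "S \<in> carrier_mat e d" by (simp add: S_def)
  have colS: "col S j = u j" if "j < d" for j using u(1)[of j] that by (auto simp: S_def)
  have TS: "T * S = 1\<^sub>m d"
    by (rule mat_col_eqI) (use T(1) S u colS in \<open>auto simp: col_mult2[OF T(1) S]\<close>)
  \<comment> \<open>From T S = 1, the vector S T v - v is killed by \<open>T\<close>, hence zero by
    injectivity; so \<open>S\<close> is a left inverse as well.\<close>
  have ST: "S * T = 1\<^sub>m e"
  proof (rule eq_mat_mult_vecI[of _ e e])
    fix v :: "complex vec" assume v: "v \<in> carrier_vec e"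
    have Tv: "T *\<^sub>v v \<in> carrier_vec d" using T(1) v by simp
    have STv: "S *\<^sub>v (T *\<^sub>v v) \<in> carrier_vec e" using S Tv by simp
    have "T *\<^sub>v (S *\<^sub>v (T *\<^sub>v v)) = T *\<^sub>v v"
      using assoc_mult_mat_vec[OF T(1) S Tv] TS Tv by simp
    hence "T *\<^sub>v (S *\<^sub>v (T *\<^sub>v v) - v) = 0\<^sub>v d"
      using mult_minus_distrib_mat_vec[OF T(1) STv v] Tv by simp
    hence z: "S *\<^sub>v (T *\<^sub>v v) - v = 0\<^sub>v e" using inj STv v by simp
    have "S *\<^sub>v (T *\<^sub>v v) = v"
    proof (rule eq_vecI)
      fix i assume "i < dim_vec v"
      hence "(S *\<^sub>v (T *\<^sub>v v) - v) $ i = 0" "i < e" using z v by auto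
      thus "(S *\<^sub>v (T *\<^sub>v v)) $ i = v $ i" using STv v by simp
    qed (use S v in auto)
    thus "S * T *\<^sub>v v = 1\<^sub>m e *\<^sub>v v" using assoc_mult_mat_vec[OF S T(1) v] v by simp
  qed (use S T in auto)
  have "mat_trace (\<sigma> g) = mat_trace (S * T * \<sigma> g)" using ST s[OF g] by simp
  also have "S * T * \<sigma> g = S * (\<rho> g * T)" using comm[OF g] assoc_mult_mat[OF S T(1) s[OF g]] by simp
  also have "mat_trace \<dots> = mat_trace (\<rho> g * T * S)"
    using r[OF g] T(1) S by (intro mat_trace_mult_comm[of _ e d]) auto
  also have "\<rho> g * T * S = \<rho> g" using assoc_mult_mat[OF r[OF g] T(1) S] TS r[OF g] by simp
  finally show ?thesis ..
qed

text \<open>The second half of Schur's lemma: \<open>T\<close> has a complex eigenvalue because d >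
  0, and its eigenspace is invariant and nonzero, hence the whole space.\<close>

lemma schur_scalar:
  assumes irr: "is_irr_rep G d \<rho>" and T: "T \<in> carrier_mat d d"
    and comm: "\<And>g. g \<in> carrier G \<Longrightarrow> \<rho> g * T = T * \<rho> g"
  obtains c where "T = c \<cdot>\<^sub>m 1\<^sub>m d"
proof -
  note r = rep_carrier[OF irr_rep_is_rep[OF irr]]
  from spectrum_non_empty[OF T irr_rep_dim_pos[OF irr]] obtain c where "eigenvalue T c"
    unfolding spectrum_def by blast
  then obtain u where u: "u \<in> carrier_vec d" "u \<noteq> 0\<^sub>v d" "T *\<^sub>v u = c \<cdot>\<^sub>v u"
    using T unfolding eigenvalue_def eigenvector_def by auto
  let ?W = "{v \<in> carrier_vec d. T *\<^sub>v v = c \<cdot>\<^sub>v v}"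
  have "?W = {0\<^sub>v d} \<or> ?W = carrier_vec d"
  proof (rule irr_rep_subspace[OF irr])
    have "T *\<^sub>v 0\<^sub>v d = c \<cdot>\<^sub>v 0\<^sub>v d" using T by (intro eq_vecI) auto
    moreover have "T *\<^sub>v (v + w) = c \<cdot>\<^sub>v (v + w)" if "v \<in> ?W" "w \<in> ?W" for v w
      using that T by (simp add: mult_add_distrib_mat_vec smult_add_distrib_vec[of _ d])
    moreover have "T *\<^sub>v (b \<cdot>\<^sub>v v) = c \<cdot>\<^sub>v (b \<cdot>\<^sub>v v)" if "v \<in> ?W" for b v
      using that T by (simp add: mult_mat_vec smult_smult_assoc mult.commute)
    ultimately show "is_subspace d ?W" unfolding is_subspace_def by auto
  next
    fix g w assume g: "g \<in> carrier G" "w \<in> ?W"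
    hence w: "w \<in> carrier_vec d" by simp
    have "T *\<^sub>v (\<rho> g *\<^sub>v w) = \<rho> g *\<^sub>v (T *\<^sub>v w)"
      using assoc_mult_mat_vec[OF r[OF g(1)] T w] assoc_mult_mat_vec[OF T r[OF g(1)] w] comm[OF g(1)] by simp
    also have "\<dots> = c \<cdot>\<^sub>v (\<rho> g *\<^sub>v w)" using g mult_mat_vec[OF r[OF g(1)] w] by simp
    finally show "\<rho> g *\<^sub>v w \<in> ?W" using r[OF g(1)] w by simp
  qed
  hence "?W = carrier_vec d" using u by blast
  hence "T = c \<cdot>\<^sub>m 1\<^sub>m d"
    by (intro eq_mat_mult_vecI[of _ d d]) (use T in \<open>auto simp: smult_one_mult_vec\<close>)
  thus thesis by (rule that)
qed

text \<open>\<open>T\<close> is the sum over g of \<rho>(g) E \<sigma>(g^-1), where E is the matrix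
  unit at \<open>(j, k)\<close>. Such sums intertwine the two representations, by the substitution
  of \<open>h \<otimes> g\<close> for \<open>g\<close>.\<close>

lemma intertwiner_matrix_unit:
  assumes rs: "is_rep G d \<rho>" "is_rep G e \<sigma>" and jk: "j < d" "k < e" and h: "h \<in> carrier G"
  defines "T \<equiv> mat d e (\<lambda>(i, l). \<Sum>g\<in>carrier G. \<rho> g $$ (i, j) * \<sigma> (inv g) $$ (k, l))"
  shows "\<rho> h * T = T * \<sigma> h"
proof (rule eq_matI)
  note r = rep_carrier[OF rs(1) h] and s = rep_carrier[OF rs(2) h]
  fix i l assume "i < dim_row (T * \<sigma> h)" "l < dim_col (T * \<sigma> h)"
  hence il: "i < d" "l < e" using s by (auto simp: T_def)
  have "(\<rho> h * T) $$ (i, l) = (\<Sum>m<d. \<rho> h $$ (i, m) * (\<Sum>g\<in>carrier G. \<rho> g $$ (m, j) * \<sigma> (inv g) $$ (k, l)))"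
    using r il by (simp add: T_def scalar_prod_def atLeast0LessThan)
  also have "\<dots> = (\<Sum>g\<in>carrier G. \<Sum>m<d. \<rho> h $$ (i, m) * \<rho> g $$ (m, j) * \<sigma> (inv g) $$ (k, l))"
    by (subst sum.swap) (simp add: sum_distrib_left mult.assoc)
  \<comment> \<open>\<open>inv g\<close> is rewritten as
    \<open>inv (h \<otimes> g) \<otimes> h\<close> so that the summand depends on \<open>g\<close>
    only through \<open>h \<otimes> g\<close>.\<close>
  also have "\<dots> = (\<Sum>g\<in>carrier G. \<rho> (h \<otimes> g) $$ (i, j) * \<sigma> (inv (h \<otimes> g) \<otimes> h) $$ (k, l))"
    by (intro sum.cong refl)
      (use rep_entry_mult[OF rs(1) h] il jk h in \<open>simp add: sum_distrib_right[symmetric] inv_mult_group m_assoc\<close>)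
  also have "\<dots> = (\<Sum>g\<in>carrier G. \<rho> g $$ (i, j) * \<sigma> (inv g \<otimes> h) $$ (k, l))"
    using sum_left_translate[OF h, of "\<lambda>g. \<rho> g $$ (i, j) * \<sigma> (inv g \<otimes> h) $$ (k, l)"] .
  also have "\<dots> = (\<Sum>g\<in>carrier G. \<Sum>m<e. \<rho> g $$ (i, j) * \<sigma> (inv g) $$ (k, m) * \<sigma> h $$ (m, l))"
    by (intro sum.cong refl)
      (use rep_entry_mult[OF rs(2) _ h] il jk in \<open>simp add: sum_distrib_left mult.assoc\<close>)
  also have "\<dots> = (\<Sum>m<e. (\<Sum>g\<in>carrier G. \<rho> g $$ (i, j) * \<sigma> (inv g) $$ (k, m)) * \<sigma> h $$ (m, l))"
    by (subst sum.swap) (simp add: sum_distrib_right)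
  also have "\<dots> = (T * \<sigma> h) $$ (i, l)"
    using s il by (simp add: T_def scalar_prod_def atLeast0LessThan)
  finally show "(\<rho> h * T) $$ (i, l) = (T * \<sigma> h) $$ (i, l)" .
qed (use rep_carrier[OF rs(1) h] rep_carrier[OF rs(2) h] in \<open>auto simp: T_def\<close>)

text \<open>The conjugate of the second trace becomes the trace at the inverse; then both traces are
  expanded. Each inner sum over \<open>g\<close> is entry \<open>(i, k)\<close> of the summed matrix
  unit at \<open>(i, k)\<close>, to which Schur's lemma applies.\<close>

lemma cf_inner_character:
  assumes rs: "is_rep G d \<rho>" "is_rep G e \<sigma>"
  shows "of_nat gorder * cf_inner G (character G \<rho>) (character G \<sigma>)
    = (\<Sum>i<d. \<Sum>k<e. \<Sum>g\<in>carrier G. \<rho> g $$ (i, i) * \<sigma> (inv g) $$ (k, k))"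
proof -
  have "of_nat gorder * cf_inner G (character G \<rho>) (character G \<sigma>)
    = (\<Sum>g\<in>carrier G. mat_trace (\<rho> g) * mat_trace (\<sigma> (inv g)))"
    using gorder_pos by (simp add: cf_inner_def character_def rep_trace_cyclotomic(2)[OF rs(2)])
  also have "\<dots> = (\<Sum>g\<in>carrier G. \<Sum>i<d. \<Sum>k<e. \<rho> g $$ (i, i) * \<sigma> (inv g) $$ (k, k))"
  proof (intro sum.cong refl)
    fix g assume g: "g \<in> carrier G"
    show "mat_trace (\<rho> g) * mat_trace (\<sigma> (inv g)) = (\<Sum>i<d. \<Sum>k<e. \<rho> g $$ (i, i) * \<sigma> (inv g) $$ (k, k))"
      using rep_carrier[OF rs(1) g] rep_carrier[OF rs(2) inv_closed[OF g]]
      by (simp add: mat_trace_def sum_product)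
  qed
  also have "\<dots> = (\<Sum>i<d. \<Sum>k<e. \<Sum>g\<in>carrier G. \<rho> g $$ (i, i) * \<sigma> (inv g) $$ (k, k))"
    by (subst sum.swap) (intro sum.cong refl sum.swap)
  finally show ?thesis .
qed

lemma Irr_orthonormal:
  assumes "\<chi> \<in> Irr G" "\<psi> \<in> Irr G"
  shows "cf_inner G \<chi> \<psi> = (if \<chi> = \<psi> then 1 else 0)"
proof (cases "\<chi> = \<psi>")
  case False
  from assms obtain d \<rho> e \<sigma> where irr: "is_irr_rep G d \<rho>" "is_irr_rep G e \<sigma>"
    and eq: "\<chi> = character G \<rho>" "\<psi> = character G \<sigma>" unfolding Irr_def by blast
  note rs = irr_rep_is_rep[OF irr(1)] irr_rep_is_rep[OF irr(2)]
  have zero: "(\<Sum>g\<in>carrier G. \<rho> g $$ (i, i) * \<sigma> (inv g) $$ (k, k)) = 0" if ik: "i < d" "k < e" for i k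
  proof -
    define T where "T = mat d e (\<lambda>(m, l). \<Sum>g\<in>carrier G. \<rho> g $$ (m, i) * \<sigma> (inv g) $$ (k, l))"
    have "T = 0\<^sub>m d e"
    proof (rule ccontr)
      assume "T \<noteq> 0\<^sub>m d e"
      hence "mat_trace (\<rho> g) = mat_trace (\<sigma> g)" if "g \<in> carrier G" for g
        using intertwiner_trace_eq[OF irr _ _ _ that, of T] intertwiner_matrix_unit[OF rs ik]
        by (auto simp: T_def)
      \<comment> \<open>The default value 0 off the carrier makes equality on the group an equality
        of functions.\<close>
      hence "\<chi> = \<psi>" unfolding eq character_def by (intro ext) simp
      thus False using False by simp
    qed
    hence "T $$ (i, k) = 0" using ik by simp
    thus ?thesis using ik by (simp add: T_def)
  qed
  hence "of_nat gorder * cf_inner G \<chi> \<psi> = 0" unfolding eq cf_inner_character[OF rs] by simp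
  thus ?thesis using gorder_pos False by simp
next
  case True
  from assms obtain d \<rho> where irr: "is_irr_rep G d \<rho>"
    and eq: "\<chi> = character G \<rho>" unfolding Irr_def by blast
  note r = irr_rep_is_rep[OF irr]
  have d: "d > 0" by (rule irr_rep_dim_pos[OF irr])
  have "(\<Sum>g\<in>carrier G. \<rho> g $$ (i, i) * \<rho> (inv g) $$ (k, k)) = (if i = k then of_nat gorder / of_nat d else 0)"
    if ik: "i < d" "k < d" for i k
  proof -
    define T where "T = mat d d (\<lambda>(m, l). \<Sum>g\<in>carrier G. \<rho> g $$ (m, i) * \<rho> (inv g) $$ (k, l))"
    from schur_scalar[OF irr, of T] intertwiner_matrix_unit[OF r r ik]
    obtain c where c: "T = c \<cdot>\<^sub>m 1\<^sub>m d" unfolding T_def by auto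
    \<comment> \<open>The scalar \<open>c\<close> is found by computing the trace twice. Summing the
      diagonal of \<open>T\<close> first collapses \<rho>(g^-1) \<rho>(g) to the identity matrix,
      leaving |G| if k = i and 0 otherwise.\<close>
    have "mat_trace T = of_nat d * c" unfolding c by (simp add: mat_trace_def)
    moreover have "mat_trace T = (\<Sum>m<d. \<Sum>g\<in>carrier G. \<rho> (inv g) $$ (k, m) * \<rho> g $$ (m, i))"
      by (simp add: mat_trace_def T_def mult.commute)
    moreover have "\<dots> = (\<Sum>g\<in>carrier G. \<rho> (inv g \<otimes> g) $$ (k, i))"
      by (subst sum.swap, intro sum.cong refl) (rule rep_entry_mult[OF r _ _ ik(2,1), symmetric]; simp)
    moreover have "\<dots> = of_nat gorder * (if k = i then 1 else 0)"
      using ik rep_one[OF r] by simp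
    ultimately have "c = (if k = i then of_nat gorder / of_nat d else 0)"
      using d by (auto simp: field_simps split: if_splits)
    moreover have "T $$ (i, k) = c * (if i = k then 1 else 0)" unfolding c using ik by simp
    ultimately show ?thesis using ik by (auto simp: T_def split: if_splits)
  qed
  hence "of_nat gorder * cf_inner G \<chi> \<psi> = (\<Sum>i<d. \<Sum>k<d. if i = k then of_nat gorder / of_nat d else 0)"
    unfolding True[symmetric] eq cf_inner_character[OF r r] by (intro sum.cong refl) auto
  also have "\<dots> = of_nat gorder" using d by simp
  finally show ?thesis using gorder_pos True by simp
qed

section \<open>Finiteness of the set of irreducible characters\<close>

lemma Irr_one:
  assumes "\<chi> \<in> Irr G"
  obtains d where "d > 0" "\<chi> \<one> = of_nat d"
proof -
  from assms obtain d \<rho> where irr: "is_irr_rep G d \<rho>" and "\<chi> = character G \<rho>" unfolding Irr_def by blast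
  hence "\<chi> \<one> = of_nat d" using rep_one[OF irr_rep_is_rep[OF irr]] by (simp add: character_def mat_trace_def)
  thus thesis using that irr_rep_dim_pos[OF irr] by blast
qed

text \<open>For a finite set \<open>F\<close> of irreducible characters take the combination
  \<open>s\<close> weighted by degrees. Orthonormality gives |G| D for the sum of |s|^2, with D the
  sum of squared degrees. The term at the identity alone is D^2, so |F| \<le> D \<le> |G|.\<close>

lemma finite_Irr: "finite (Irr G)"
proof -
  have bound: "card F \<le> gorder" if F: "finite F" "F \<subseteq> Irr G" for F
  proof -
    have "\<forall>\<chi>\<in>F. \<exists>d. d > 0 \<and> \<chi> \<one> = of_nat d" using Irr_one F by blast
    then obtain d :: "_ \<Rightarrow> nat" where d: "\<And>\<chi>. \<chi> \<in> F \<Longrightarrow> d \<chi> > 0" "\<And>\<chi>. \<chi> \<in> F \<Longrightarrow> \<chi> \<one> = of_nat (d \<chi>)" by metis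
    define D where "D = (\<Sum>\<chi>\<in>F. d \<chi> * d \<chi>)"
    define s where "s = (\<lambda>g. \<Sum>\<chi>\<in>F. of_nat (d \<chi>) * \<chi> g)"
    have s1: "s \<one> = of_nat D" unfolding s_def D_def using d(2) by simp
    have ip: "(\<Sum>g\<in>carrier G. \<chi> g * cnj (\<psi> g)) = of_nat gorder * (if \<chi> = \<psi> then 1 else 0)"
      if "\<chi> \<in> F" "\<psi> \<in> F" for \<chi> \<psi>
    proof -
      have "\<chi> \<in> Irr G" "\<psi> \<in> Irr G" using that F by auto
      from Irr_orthonormal[OF this] show ?thesis
        using gorder_pos by (simp add: cf_inner_def divide_eq_eq split: if_splits)
    qed
    have "(\<Sum>g\<in>carrier G. s g * cnj (s g))
        = (\<Sum>g\<in>carrier G. \<Sum>\<chi>\<in>F. \<Sum>\<psi>\<in>F. of_nat (d \<chi> * d \<psi>) * (\<chi> g * cnj (\<psi> g)))"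
      by (simp add: s_def sum_product mult_ac)
    also have "\<dots> = (\<Sum>\<chi>\<in>F. \<Sum>\<psi>\<in>F. \<Sum>g\<in>carrier G. of_nat (d \<chi> * d \<psi>) * (\<chi> g * cnj (\<psi> g)))"
      by (subst sum.swap) (intro sum.cong refl sum.swap)
    also have "\<dots> = (\<Sum>\<chi>\<in>F. \<Sum>\<psi>\<in>F. if \<chi> = \<psi> then of_nat (d \<chi> * d \<chi>) * of_nat gorder else 0)"
      by (intro sum.cong refl) (auto simp: sum_distrib_left[symmetric] ip)
    also have "\<dots> = of_nat (gorder * D)"
      using F by (simp add: D_def sum_distrib_left mult_ac)
    finally have "complex_of_real (\<Sum>g\<in>carrier G. (norm (s g))\<^sup>2) = of_real (of_nat (gorder * D))"
      unfolding of_real_sum complex_norm_square by simp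
    hence "(\<Sum>g\<in>carrier G. (norm (s g))\<^sup>2) = of_nat (gorder * D)" unfolding of_real_eq_iff .
    moreover have "(norm (s \<one>))\<^sup>2 \<le> (\<Sum>g\<in>carrier G. (norm (s g))\<^sup>2)"
      by (rule member_le_sum) (use fin in auto)
    ultimately have "real (D * D) \<le> real (gorder * D)" by (simp add: s1 power2_eq_square)
    hence "D \<le> gorder" by (cases "D = 0") auto
    moreover have "card F \<le> D"
      unfolding D_def card_eq_sum using d(1) by (intro sum_mono) (simp add: Suc_le_eq)
    ultimately show ?thesis by simp
  qed
  show ?thesis
  proof (rule ccontr)
    assume "infinite (Irr G)"
    then obtain F where "finite F" "card F = Suc gorder" "F \<subseteq> Irr G"
      using infinite_arbitrarily_large by metis
    thus False using bound by fastforce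
  qed
qed

end

section \<open>Splitting off subrepresentations\<close>

lemma inverse_mat_if_kernel_trivial:
  fixes P :: "complex mat"
  assumes P: "P \<in> carrier_mat d d"
    and inj: "\<And>x. x \<in> carrier_vec d \<Longrightarrow> P *\<^sub>v x = 0\<^sub>v d \<Longrightarrow> x = 0\<^sub>v d"
  obtains Q where "Q \<in> carrier_mat d d" "P * Q = 1\<^sub>m d" "Q * P = 1\<^sub>m d"
proof -
  have "det P \<noteq> 0" unfolding det_0_iff_vec_prod_zero[OF P] using inj by blast
  from det_non_zero_imp_unit[OF P this, of "()"] show thesis
    using that unfolding Units_def ring_mat_def by auto
qed

text \<open>The product is a combination of the first \<open>k\<close> columns; the truncations
  \<open>t m\<close> of \<open>v\<close> add these one at a time.\<close>

lemma subspace_mult_vec: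
  assumes W: "is_subspace d W" and P: "P \<in> carrier_mat d d" and v: "v \<in> carrier_vec d"
    and k: "k \<le> d" and cols: "\<And>j. j < k \<Longrightarrow> col P j \<in> W"
    and zero: "\<And>i. k \<le> i \<Longrightarrow> i < d \<Longrightarrow> v $ i = 0"
  shows "P *\<^sub>v v \<in> W"
proof -
  define t where "t = (\<lambda>m. vec d (\<lambda>i. if i < m then v $ i else 0))"
  have t: "t m \<in> carrier_vec d" for m by (simp add: t_def)
  have "m \<le> k \<Longrightarrow> P *\<^sub>v t m \<in> W" for m
  proof (induction m)
    case 0
    have "P *\<^sub>v t 0 = 0\<^sub>v d" using P by (intro eq_vecI) (auto simp: t_def scalar_prod_def)
    thus ?case using W by (simp add: is_subspace_def)
  next
    case (Suc m)
    have m: "m < d" using Suc k by simp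
    have "t (Suc m) = t m + v $ m \<cdot>\<^sub>v unit_vec d m"
      using m by (intro eq_vecI) (auto simp: t_def less_Suc_eq)
    hence "P *\<^sub>v t (Suc m) = P *\<^sub>v t m + v $ m \<cdot>\<^sub>v col P m"
      using P t[of m] m by (simp add: mult_add_distrib_mat_vec mult_mat_vec mult_mat_unit_vec)
    thus ?case using Suc cols[of m] W by (simp add: is_subspace_def)
  qed
  moreover have "t k = v" using v zero by (intro eq_vecI) (auto simp: t_def not_less)
  ultimately show ?thesis by force
qed

text \<open>Steinitz exchange: take an invertible matrix with as many leading columns in the subspace as
  possible; a vector of the subspace outside their span could replace a further column.\<close>

lemma subspace_adapted_basis:
  assumes W: "is_subspace d W"
  obtains k P Q where "k \<le> d" "P \<in> carrier_mat d d" "Q \<in> carrier_mat d d" "P * Q = 1\<^sub>m d" "Q * P = 1\<^sub>m d"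
    and "\<And>v. v \<in> carrier_vec d \<Longrightarrow> P *\<^sub>v v \<in> W \<longleftrightarrow> (\<forall>i. k \<le> i \<longrightarrow> i < d \<longrightarrow> v $ i = 0)"
proof -
  \<comment> \<open>Invertibility is expressed as trivial kernel. \<open>good\<close> holds at 0 and
    fails above \<open>d\<close>, so there is a \<open>k\<close> at which it holds while it fails at
    the successor.\<close>
  define good where "good = (\<lambda>k. k \<le> d \<and> (\<exists>P\<in>carrier_mat d d.
    (\<forall>x\<in>carrier_vec d. P *\<^sub>v x = 0\<^sub>v d \<longrightarrow> x = 0\<^sub>v d) \<and> (\<forall>j<k. col P j \<in> W)))"
  have "good 0" unfolding good_def by (auto intro!: bexI[of _ "1\<^sub>m d"])
  have "\<exists>k. good k \<and> \<not> good (Suc k)"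
  proof (rule ccontr)
    assume "\<not> ?thesis"
    hence "good k" for k by (induction k) (use \<open>good 0\<close> in auto)
    from this[of "Suc d"] show False by (simp add: good_def)
  qed
  then obtain k where k: "good k" "\<not> good (Suc k)" by blast
  then obtain P where kd: "k \<le> d" and P: "P \<in> carrier_mat d d"
    and inj: "\<And>x. x \<in> carrier_vec d \<Longrightarrow> P *\<^sub>v x = 0\<^sub>v d \<Longrightarrow> x = 0\<^sub>v d"
    and cols: "\<And>j. j < k \<Longrightarrow> col P j \<in> W" unfolding good_def by blast
  obtain Q where Q: "Q \<in> carrier_mat d d" "P * Q = 1\<^sub>m d" "Q * P = 1\<^sub>m d"
    using inverse_mat_if_kernel_trivial[OF P inj] by blast
  have zero: "v $ j = 0" if v: "v \<in> carrier_vec d" "P *\<^sub>v v \<in> W" and j: "k \<le> j" "j < d" for v j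
  proof (rule ccontr)
    assume vj: "v $ j \<noteq> 0"
    \<comment> \<open>\<open>\<tau>\<close> swaps \<open>j\<close> and \<open>k\<close>.
      \<open>P'\<close> has the vector P v as column \<open>k\<close> and the old column
      \<open>k\<close> at position \<open>j\<close>; the old column \<open>j\<close> is dropped,
      which P v can replace because \<open>v $ j\<close> is nonzero.\<close>
    define \<tau> where "\<tau> = (\<lambda>c. if c = j then k else if c = k then j else c)"
    define P' where "P' = mat d d (\<lambda>(r, c). if c = k then (P *\<^sub>v v) $ r else P $$ (r, \<tau> c))"
    have P': "P' \<in> carrier_mat d d" by (simp add: P'_def)
    have kd': "k < d" using j by simp
    have "col P' c \<in> W" if "c < Suc k" for c
    proof (cases "c = k")
      case True
      hence "col P' c = P *\<^sub>v v" using P kd' by (intro eq_vecI) (auto simp: P'_def)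
      thus ?thesis using v by simp
    next
      case False
      hence "c < k" "\<tau> c = c" using that j by (auto simp: \<tau>_def)
      hence "col P' c = col P c" using P kd' by (intro eq_vecI) (auto simp: P'_def)
      thus ?thesis using cols \<open>c < k\<close> by simp
    qed
    moreover have "x = 0\<^sub>v d" if x: "x \<in> carrier_vec d" "P' *\<^sub>v x = 0\<^sub>v d" for x
    proof -
      \<comment> \<open>The coordinates of P' x with respect to the columns of \<open>P\<close>.
        Once \<open>y\<close> vanishes, coordinate \<open>j\<close> gives x_k v_j = 0, so x_k = 0,
        and the other coordinates then clear the rest of \<open>x\<close>.\<close>
      define y where "y = vec d (\<lambda>i. x $ k * v $ i + (if i = j then 0 else x $ \<tau> i))"
      have y: "y \<in> carrier_vec d" by (simp add: y_def)
      have "P' *\<^sub>v x = P *\<^sub>v y"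
      proof (rule eq_vecI)
        fix r assume "r < dim_vec (P *\<^sub>v y)"
        hence r: "r < d" using P by simp
        have "(P' *\<^sub>v x) $ r = (\<Sum>c<d. P' $$ (r, c) * x $ c)"
          using P' x(1) r by (simp add: scalar_prod_def atLeast0LessThan)
        also have "\<dots> = P' $$ (r, k) * x $ k + (\<Sum>c\<in>{..<d} - {k}. P' $$ (r, c) * x $ c)"
          using kd' by (subst sum.remove[of _ k]) auto
        also have "(\<Sum>c\<in>{..<d} - {k}. P' $$ (r, c) * x $ c) = (\<Sum>c\<in>{..<d} - {k}. P $$ (r, \<tau> c) * x $ c)"
          using r by (intro sum.cong) (auto simp: P'_def)
        also have "\<dots> = (\<Sum>c\<in>{..<d} - {j}. P $$ (r, c) * x $ \<tau> c)"
          using j kd' by (intro sum.reindex_bij_witness[of _ \<tau> \<tau>]) (auto simp: \<tau>_def split: if_splits)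
        also have "\<dots> = (\<Sum>c<d. P $$ (r, c) * (if c = j then 0 else x $ \<tau> c))"
          using j by (subst (2) sum.remove[of _ j]) auto
        also have "P' $$ (r, k) * x $ k = (\<Sum>c<d. P $$ (r, c) * (x $ k * v $ c))"
          using r kd' P v by (simp add: P'_def scalar_prod_def atLeast0LessThan sum_distrib_left sum_distrib_right mult_ac)
        also have "(\<Sum>c<d. P $$ (r, c) * (x $ k * v $ c)) + (\<Sum>c<d. P $$ (r, c) * (if c = j then 0 else x $ \<tau> c))
          = (\<Sum>c<d. P $$ (r, c) * y $ c)"
          unfolding sum.distrib[symmetric] by (intro sum.cong refl) (auto simp: y_def distrib_left)
        also have "\<dots> = (P *\<^sub>v y) $ r"
          using P y r by (simp add: scalar_prod_def atLeast0LessThan)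
        finally show "(P' *\<^sub>v x) $ r = (P *\<^sub>v y) $ r" .
      qed (use P P' in auto)
      hence y0: "y = 0\<^sub>v d" using inj[OF y] x by simp
      have yi: "x $ k * v $ i + (if i = j then 0 else x $ \<tau> i) = 0" if "i < d" for i
      proof -
        have "y $ i = 0" using y0 that by simp
        thus ?thesis using that by (simp add: y_def)
      qed
      have xk: "x $ k = 0" using yi[OF j(2)] vj by simp
      show "x = 0\<^sub>v d"
      proof (rule eq_vecI)
        fix i assume "i < dim_vec (0\<^sub>v d)"
        hence i: "i < d" by simp
        show "x $ i = 0\<^sub>v d $ i"
        proof (cases "i = k")
          case False
          have "\<tau> i < d" "\<tau> i \<noteq> j" "\<tau> (\<tau> i) = i" using False i j kd' by (auto simp: \<tau>_def)
          thus ?thesis using yi[of "\<tau> i"] xk i by simp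
        qed (use xk i in simp)
      qed (use x in simp)
    qed
    ultimately have "good (Suc k)" unfolding good_def using P' kd' by (intro conjI bexI[of _ P']) auto
    thus False using k by simp
  qed
  show thesis
  proof (rule that[OF kd P Q])
    fix v :: "complex vec" assume v: "v \<in> carrier_vec d"
    show "P *\<^sub>v v \<in> W \<longleftrightarrow> (\<forall>i. k \<le> i \<longrightarrow> i < d \<longrightarrow> v $ i = 0)"
      using zero[OF v] subspace_mult_vec[OF W P v kd cols] by blast
  qed
qed

lemma sum_split_nat:
  fixes f :: "nat \<Rightarrow> complex"
  assumes "k \<le> d"
  shows "(\<Sum>i<d. f i) = (\<Sum>i<k. f i) + (\<Sum>i<d - k. f (i + k))"
proof -
  have "(\<Sum>i<d. f i) = (\<Sum>i<k. f i) + (\<Sum>i=k..<d. f i)"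
    using assms by (metis atLeast0LessThan sum.atLeastLessThan_concat zero_le)
  thus ?thesis using assms sum.shift_bounds_nat_ivl[of f 0 k "d - k"] by (simp add: atLeast0LessThan)
qed

context finite_grp
begin

section \<open>Block triangular form of a reducible representation\<close>

lemma rep_conjugate:
  assumes r: "is_rep G d \<rho>" and PQ: "P \<in> carrier_mat d d" "Q \<in> carrier_mat d d" "P * Q = 1\<^sub>m d" "Q * P = 1\<^sub>m d"
  shows "is_rep G d (\<lambda>g. Q * \<rho> g * P)"
  unfolding is_rep_def
proof (intro conjI ballI)
  note c = rep_carrier[OF r]
  show "Q * \<rho> \<one> * P = 1\<^sub>m d" using PQ rep_one[OF r] by simp
  fix g assume g: "g \<in> carrier G"
  show "Q * \<rho> g * P \<in> carrier_mat d d" using PQ c[OF g] by simp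
  fix h assume h: "h \<in> carrier G"
  note [simp] = assoc_mult_mat[of _ d d _ d _ d]
  have "Q * \<rho> g * P * (Q * \<rho> h * P) = Q * \<rho> g * (P * Q) * \<rho> h * P"
    using PQ(1,2) c[OF g] c[OF h] by simp
  also have "\<dots> = Q * \<rho> (g \<otimes> h) * P"
    using PQ c[OF g] c[OF h] rep_mult[OF r g h] by simp
  finally show "Q * \<rho> (g \<otimes> h) * P = Q * \<rho> g * P * (Q * \<rho> h * P)" ..
qed

text \<open>These are the subrepresentation and the quotient. In the matrix product the sum over the
  middle index splits at \<open>k\<close>, and the zero block kills one of the two parts.\<close>

lemma block_triangular_reps:
  assumes r: "is_rep G d \<rho>" and k: "k \<le> d"
    and zero: "\<And>g i j. g \<in> carrier G \<Longrightarrow> k \<le> i \<Longrightarrow> i < d \<Longrightarrow> j < k \<Longrightarrow> \<rho> g $$ (i, j) = 0"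
  shows "is_rep G k (\<lambda>g. mat k k (\<lambda>(i, j). \<rho> g $$ (i, j)))" (is "is_rep G k ?A")
    and "is_rep G (d - k) (\<lambda>g. mat (d - k) (d - k) (\<lambda>(i, j). \<rho> g $$ (i + k, j + k)))" (is "is_rep G (d - k) ?D")
proof -
  show "is_rep G k ?A" unfolding is_rep_def
  proof (intro conjI ballI)
    show "?A \<one> = 1\<^sub>m k" using k by (intro eq_matI) (auto simp: rep_one[OF r])
    fix g h assume gh: "g \<in> carrier G" "h \<in> carrier G"
    show "?A (g \<otimes> h) = ?A g * ?A h"
    proof (rule eq_matI)
      fix i j assume "i < dim_row (?A g * ?A h)" "j < dim_col (?A g * ?A h)"
      hence ij: "i < k" "j < k" by auto
      have "\<rho> (g \<otimes> h) $$ (i, j) = (\<Sum>l<k. \<rho> g $$ (i, l) * \<rho> h $$ (l, j))"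
        using rep_entry_mult[OF r gh, of i j] ij k zero[OF gh(2)] by (simp add: sum_split_nat[OF k])
      thus "?A (g \<otimes> h) $$ (i, j) = (?A g * ?A h) $$ (i, j)"
        using ij by (simp add: scalar_prod_def atLeast0LessThan)
    qed auto
  qed auto
  show "is_rep G (d - k) ?D" unfolding is_rep_def
  proof (intro conjI ballI)
    show "?D \<one> = 1\<^sub>m (d - k)" using k by (intro eq_matI) (auto simp: rep_one[OF r])
    fix g h assume gh: "g \<in> carrier G" "h \<in> carrier G"
    show "?D (g \<otimes> h) = ?D g * ?D h"
    proof (rule eq_matI)
      fix i j assume "i < dim_row (?D g * ?D h)" "j < dim_col (?D g * ?D h)"
      hence ij: "i < d - k" "j < d - k" by auto
      have "\<rho> (g \<otimes> h) $$ (i + k, j + k) = (\<Sum>l<d - k. \<rho> g $$ (i + k, l + k) * \<rho> h $$ (l + k, j + k))"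
        using rep_entry_mult[OF r gh, of "i + k" "j + k"] ij k zero[OF gh(1)] by (simp add: sum_split_nat[OF k])
      thus "?D (g \<otimes> h) $$ (i, j) = (?D g * ?D h) $$ (i, j)"
        using ij by (simp add: scalar_prod_def atLeast0LessThan)
    qed auto
  qed auto
qed

text \<open>In a basis adapted to a proper nonzero invariant subspace the matrices are block
  triangular, and the trace sees only the diagonal blocks.\<close>

lemma reducible_rep_trace:
  assumes r: "is_rep G d \<rho>" and d: "d > 0" and nirr: "\<not> is_irr_rep G d \<rho>"
  obtains k A D where "0 < k" "k < d" "is_rep G k A" "is_rep G (d - k) D"
    and "\<And>g. g \<in> carrier G \<Longrightarrow> mat_trace (\<rho> g) = mat_trace (A g) + mat_trace (D g)"
proof -
  from nirr r d obtain W where W: "is_subspace d W" "W \<noteq> {0\<^sub>v d}" "W \<noteq> carrier_vec d"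
    and inv: "\<And>g w. g \<in> carrier G \<Longrightarrow> w \<in> W \<Longrightarrow> \<rho> g *\<^sub>v w \<in> W"
    unfolding is_irr_rep_def by blast
  from subspace_adapted_basis[OF W(1)] obtain k P Q
    where k: "k \<le> d" and P: "P \<in> carrier_mat d d" and Q: "Q \<in> carrier_mat d d"
      and PQ: "P * Q = 1\<^sub>m d" "Q * P = 1\<^sub>m d"
      and iff: "\<And>v. v \<in> carrier_vec d \<Longrightarrow> P *\<^sub>v v \<in> W \<longleftrightarrow> (\<forall>i. k \<le> i \<longrightarrow> i < d \<longrightarrow> v $ i = 0)"
    by metis
  have PQv: "P *\<^sub>v (Q *\<^sub>v w) = w" if "w \<in> carrier_vec d" for w
    using assoc_mult_mat_vec[OF P Q that] PQ that by simp
  have Wc: "W \<subseteq> carrier_vec d" "0\<^sub>v d \<in> W" using W(1) by (auto simp: is_subspace_def)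
  have "k \<noteq> 0"
  proof
    assume k0: "k = 0"
    have "w = 0\<^sub>v d" if "w \<in> W" for w
    proof -
      have w: "w \<in> carrier_vec d" using that Wc by blast
      hence Qw: "Q *\<^sub>v w \<in> carrier_vec d" using Q by simp
      hence "\<forall>i<d. (Q *\<^sub>v w) $ i = 0" using iff[OF Qw] PQv[OF w] that k0 by simp
      hence "Q *\<^sub>v w = 0\<^sub>v d" using Q by (intro eq_vecI) auto
      hence "w = P *\<^sub>v 0\<^sub>v d" using PQv[OF w] by simp
      also have "\<dots> = 0\<^sub>v d" using P by (intro eq_vecI) auto
      finally show ?thesis .
    qed
    thus False using W(2) Wc by blast
  qed
  moreover have "k \<noteq> d"
  proof
    assume kd: "k = d"
    have "w \<in> W" if "w \<in> carrier_vec d" for w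
      using iff[of "Q *\<^sub>v w"] PQv[OF that] that Q kd by simp
    thus False using W(3) Wc by blast
  qed
  ultimately have k': "0 < k" "k < d" using k by auto
  let ?r = "\<lambda>g. Q * \<rho> g * P"
  have r': "is_rep G d ?r" by (rule rep_conjugate[OF r P Q PQ])
  have zero: "?r g $$ (i, j) = 0" if g: "g \<in> carrier G" and ij: "k \<le> i" "i < d" "j < k" for g i j
  proof -
    note c = rep_carrier[OF r g] and c' = rep_carrier[OF r' g]
    let ?e = "unit_vec d j :: complex vec"
    have j: "j < d" using ij k by simp
    \<comment> \<open>Column \<open>j\<close> of \<open>?r g\<close> lists the coordinates of
      \<rho>(g) P e_j in the adapted basis. For j < k this vector stays in \<open>W\<close>, so the
      coordinates from \<open>k\<close> on vanish.\<close>
    have "P *\<^sub>v ?e \<in> W" using iff[of ?e] ij j by auto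
    hence "\<rho> g *\<^sub>v (P *\<^sub>v ?e) \<in> W" by (rule inv[OF g])
    moreover have "\<rho> g *\<^sub>v (P *\<^sub>v ?e) \<in> carrier_vec d" using c P by simp
    ultimately have "P *\<^sub>v (Q *\<^sub>v (\<rho> g *\<^sub>v (P *\<^sub>v ?e))) \<in> W" using PQv by simp
    moreover have "Q *\<^sub>v (\<rho> g *\<^sub>v (P *\<^sub>v ?e)) = ?r g *\<^sub>v ?e"
      using c P Q by (simp add: assoc_mult_mat_vec[of _ d d _ d])
    ultimately have "(?r g *\<^sub>v ?e) $ i = 0" using iff[of "?r g *\<^sub>v ?e"] c' ij by auto
    moreover have "col (?r g) j $ i = ?r g $$ (i, j)" by (rule index_col) (use P Q ij j in auto)
    ultimately show ?thesis using mult_mat_unit_vec[OF c' j] by simp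
  qed
  have tr: "mat_trace (\<rho> g) = mat_trace (?r g)" if g: "g \<in> carrier G" for g
  proof -
    note c = rep_carrier[OF r g]
    have "mat_trace (?r g) = mat_trace (P * (Q * \<rho> g))"
      by (rule mat_trace_mult_comm[of _ d d]) (use c P Q in auto)
    also have "P * (Q * \<rho> g) = \<rho> g" using assoc_mult_mat[OF P Q c] PQ c by simp
    finally show ?thesis ..
  qed
  show thesis
  proof (rule that[OF k' block_triangular_reps[OF r' k zero]])
    fix g assume g: "g \<in> carrier G"
    show "mat_trace (\<rho> g) = mat_trace (mat k k (\<lambda>(i, j). ?r g $$ (i, j)))
      + mat_trace (mat (d - k) (d - k) (\<lambda>(i, j). ?r g $$ (i + k, j + k)))"
      unfolding tr[OF g] using rep_carrier[OF r' g] sum_split_nat[OF k, of "\<lambda>i. ?r g $$ (i, i)"]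
      by (simp add: mat_trace_def del: index_mult_mat)
  qed
qed

text \<open>Strong induction on the degree: the trace of a reducible representation is the sum of
  the traces of two smaller ones.\<close>

lemma orthogonal_to_Irr_imp_chars:
  assumes orth: "\<And>\<chi>. \<chi> \<in> Irr G \<Longrightarrow> (\<Sum>g\<in>carrier G. f g * \<chi> g) = 0"
    and r: "is_rep G d \<rho>"
  shows "(\<Sum>g\<in>carrier G. f g * mat_trace (\<rho> g)) = 0"
  using r
proof (induction d arbitrary: \<rho> rule: less_induct)
  case (less d)
  show ?case
  proof (cases "d = 0")
    case True
    have "mat_trace (\<rho> g) = 0" if "g \<in> carrier G" for g
      using rep_carrier[OF less.prems that] True by (simp add: mat_trace_def)
    thus ?thesis by simp
  next
    case False
    show ?thesis
    proof (cases "is_irr_rep G d \<rho>")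
      case True
      hence "character G \<rho> \<in> Irr G" unfolding Irr_def by blast
      from orth[OF this] show ?thesis by (simp add: character_def)
    next
      case nirr: False
      obtain k A D where k: "0 < k" "k < d" "is_rep G k A" "is_rep G (d - k) D"
        and tr: "\<And>g. g \<in> carrier G \<Longrightarrow> mat_trace (\<rho> g) = mat_trace (A g) + mat_trace (D g)"
        using reducible_rep_trace[OF less.prems _ nirr] False by blast
      have "(\<Sum>g\<in>carrier G. f g * mat_trace (\<rho> g))
        = (\<Sum>g\<in>carrier G. f g * mat_trace (A g)) + (\<Sum>g\<in>carrier G. f g * mat_trace (D g))"
        by (simp add: tr distrib_left sum.distrib)
      thus ?thesis using less.IH[OF _ k(3)] less.IH[OF _ k(4)] k by simp
    qed
  qed
qed

end

section \<open>Column orthogonality\<close>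

context finite_grp
begin

text \<open>The regular representation, by permutation matrices for left multiplication with respect
  to an enumeration \<open>b\<close>. Only the identity fixes a point.\<close>

lemma is_char_regular: "is_char (\<lambda>g. if g = \<one> then of_nat gorder else 0)"
proof -
  from ex_bij_betw_nat_finite[OF fin] obtain b where b: "bij_betw b {..<gorder} (carrier G)"
    by (auto simp: atLeast0LessThan)
  have bc: "b i \<in> carrier G" if "i < gorder" for i using b that by (auto simp: bij_betw_def)
  have binj: "b i = b j \<longleftrightarrow> i = j" if "i < gorder" "j < gorder" for i j
    using b that by (auto simp: bij_betw_def inj_on_def)
  define \<rho> where "\<rho> = (\<lambda>g. mat gorder gorder (\<lambda>(i, j). if g \<otimes> b j = b i then 1 else 0 :: complex))"
  have "is_rep G gorder \<rho>" unfolding is_rep_def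
  proof (intro conjI ballI)
    show "\<rho> \<one> = 1\<^sub>m gorder" by (rule eq_matI) (auto simp: \<rho>_def bc binj)
    fix g h assume gh: "g \<in> carrier G" "h \<in> carrier G"
    show "\<rho> (g \<otimes> h) = \<rho> g * \<rho> h"
    proof (rule eq_matI)
      fix i j assume "i < dim_row (\<rho> g * \<rho> h)" "j < dim_col (\<rho> g * \<rho> h)"
      hence ij: "i < gorder" "j < gorder" by (auto simp: \<rho>_def)
      have "h \<otimes> b j \<in> b ` {..<gorder}" using b gh bc[OF ij(2)] by (simp add: bij_betw_def)
      then obtain l where l: "l < gorder" "h \<otimes> b j = b l" by auto
      have "(\<rho> g * \<rho> h) $$ (i, j) = (\<Sum>k<gorder. (if g \<otimes> b k = b i then 1 else 0) * (if h \<otimes> b j = b k then 1 else 0))"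
        using ij by (simp add: \<rho>_def scalar_prod_def atLeast0LessThan)
      also have "\<dots> = (\<Sum>k<gorder. if k = l then (if g \<otimes> b l = b i then 1 else 0) else 0)"
        by (intro sum.cong refl) (auto simp: l binj)
      also have "\<dots> = (if g \<otimes> h \<otimes> b j = b i then 1 else 0)"
        using l gh bc[OF ij(2)] by (simp add: m_assoc)
      finally show "\<rho> (g \<otimes> h) $$ (i, j) = (\<rho> g * \<rho> h) $$ (i, j)" using ij by (simp add: \<rho>_def)
    qed (auto simp: \<rho>_def)
  qed (simp add: \<rho>_def)
  moreover have "(if g = \<one> then of_nat gorder else 0) = mat_trace (\<rho> g)" if g: "g \<in> carrier G" for g
  proof -
    have "mat_trace (\<rho> g) = (\<Sum>i<gorder. if g = \<one> then 1 else 0)"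
      unfolding mat_trace_def using bc g by (intro sum.cong) (auto simp: \<rho>_def)
    thus ?thesis by simp
  qed
  ultimately show ?thesis unfolding is_char_def by blast
qed

section \<open>Class functions and completeness of the irreducible characters\<close>

definition class_function :: "('a \<Rightarrow> complex) \<Rightarrow> bool" where
  "class_function f \<longleftrightarrow> (\<forall>x\<in>carrier G. \<forall>g\<in>carrier G. f (x \<otimes> g \<otimes> inv x) = f g)"

lemma class_functionD:
  "class_function f \<Longrightarrow> x \<in> carrier G \<Longrightarrow> g \<in> carrier G \<Longrightarrow> f (x \<otimes> g \<otimes> inv x) = f g"
  by (simp add: class_function_def)

lemma class_function_is_char:
  assumes "is_char f"
  shows "class_function f"
  unfolding class_function_def
proof (intro ballI)
  fix x g assume xg: "x \<in> carrier G" "g \<in> carrier G"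
  from assms obtain d \<rho> where r: "is_rep G d \<rho>" and f: "\<And>g. g \<in> carrier G \<Longrightarrow> f g = mat_trace (\<rho> g)"
    unfolding is_char_def by blast
  have "mat_trace (\<rho> (x \<otimes> g) * \<rho> (inv x)) = mat_trace (\<rho> (inv x) * \<rho> (x \<otimes> g))"
    by (rule mat_trace_mult_comm[of _ d d]) (use rep_carrier[OF r] xg in auto)
  thus "f (x \<otimes> g \<otimes> inv x) = f g"
    using xg by (simp add: f rep_mult[OF r, symmetric] m_assoc[symmetric])
qed

lemma class_function_swap:
  assumes "class_function f" "x \<in> carrier G" "g \<in> carrier G"
  shows "f (x \<otimes> g) = f (g \<otimes> x)"
  using class_functionD[OF assms(1,2), of "g \<otimes> x"] assms(2,3) by (simp add: m_assoc)

text \<open>By Schur's lemma \<open>\<Sum>\<^sub>g f(g) \<rho>(g)\<close> is a scalar of trace 0 for every irreducible \<open>\<rho>\<close>, hence 0; so every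
  translate of \<open>f\<close> is orthogonal to all characters, in particular to the regular one.\<close>

lemma class_function_orthogonal_zero:
  assumes f: "class_function f"
    and orth: "\<And>\<chi>. \<chi> \<in> Irr G \<Longrightarrow> (\<Sum>g\<in>carrier G. f g * \<chi> g) = 0"
    and h: "h \<in> carrier G"
  shows "f h = 0"
proof -
  have zero: "(\<Sum>g\<in>carrier G. f (h \<otimes> g) * \<chi> g) = 0" if \<chi>: "\<chi> \<in> Irr G" for \<chi>
  proof -
    from \<chi> obtain d \<rho> where irr: "is_irr_rep G d \<rho>" and chi: "\<chi> = character G \<rho>" unfolding Irr_def by blast
    note r = irr_rep_is_rep[OF irr]
    define T where "T = mat d d (\<lambda>(i, j). \<Sum>g\<in>carrier G. f g * \<rho> g $$ (i, j))"
    have T: "T \<in> carrier_mat d d" by (simp add: T_def)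
    \<comment> \<open>This formula serves twice: compared with \<open>Tr\<close> it shows that
      \<open>T\<close> commutes with the representation, and after T = 0 it is read at x = h^-1 to
      get orthogonality of the translate of \<open>f\<close>.\<close>
    have lT: "(\<rho> x * T) $$ (i, j) = (\<Sum>g\<in>carrier G. f (inv x \<otimes> g) * \<rho> g $$ (i, j))"
      if x: "x \<in> carrier G" and ij: "i < d" "j < d" for x i j
    proof -
      have "(\<rho> x * T) $$ (i, j) = (\<Sum>k<d. \<rho> x $$ (i, k) * (\<Sum>g\<in>carrier G. f g * \<rho> g $$ (k, j)))"
        using rep_carrier[OF r x] ij by (simp add: T_def scalar_prod_def atLeast0LessThan)
      also have "\<dots> = (\<Sum>g\<in>carrier G. f g * (\<Sum>k<d. \<rho> x $$ (i, k) * \<rho> g $$ (k, j)))"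
        unfolding sum_distrib_left by (subst sum.swap) (simp add: mult_ac)
      also have "\<dots> = (\<Sum>g\<in>carrier G. f (inv x \<otimes> (x \<otimes> g)) * \<rho> (x \<otimes> g) $$ (i, j))"
        by (intro sum.cong refl) (use rep_entry_mult[OF r x _ ij] x in \<open>simp add: m_assoc[symmetric]\<close>)
      also have "\<dots> = (\<Sum>g\<in>carrier G. f (inv x \<otimes> g) * \<rho> g $$ (i, j))"
        using sum_left_translate[OF x, of "\<lambda>g. f (inv x \<otimes> g) * \<rho> g $$ (i, j)"] .
      finally show ?thesis .
    qed
    have Tr: "(T * \<rho> x) $$ (i, j) = (\<Sum>g\<in>carrier G. f (g \<otimes> inv x) * \<rho> g $$ (i, j))"
      if x: "x \<in> carrier G" and ij: "i < d" "j < d" for x i j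
    proof -
      have "(T * \<rho> x) $$ (i, j) = (\<Sum>k<d. (\<Sum>g\<in>carrier G. f g * \<rho> g $$ (i, k)) * \<rho> x $$ (k, j))"
        using rep_carrier[OF r x] ij by (simp add: T_def scalar_prod_def atLeast0LessThan)
      also have "\<dots> = (\<Sum>g\<in>carrier G. f g * (\<Sum>k<d. \<rho> g $$ (i, k) * \<rho> x $$ (k, j)))"
        unfolding sum_distrib_left sum_distrib_right by (subst sum.swap) (simp add: mult_ac)
      also have "\<dots> = (\<Sum>g\<in>carrier G. f (g \<otimes> x \<otimes> inv x) * \<rho> (g \<otimes> x) $$ (i, j))"
        by (intro sum.cong refl) (use rep_entry_mult[OF r _ x ij] x in \<open>simp add: m_assoc\<close>)
      also have "\<dots> = (\<Sum>g\<in>carrier G. f (g \<otimes> inv x) * \<rho> g $$ (i, j))"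
        using sum_right_translate[OF x, of "\<lambda>g. f (g \<otimes> inv x) * \<rho> g $$ (i, j)"] .
      finally show ?thesis .
    qed
    have "\<rho> x * T = T * \<rho> x" if x: "x \<in> carrier G" for x
    proof (rule eq_matI)
      fix i j assume "i < dim_row (T * \<rho> x)" "j < dim_col (T * \<rho> x)"
      hence ij: "i < d" "j < d" using rep_carrier[OF r x] T by auto
      show "(\<rho> x * T) $$ (i, j) = (T * \<rho> x) $$ (i, j)"
        unfolding lT[OF x ij] Tr[OF x ij]
        by (intro sum.cong refl) (use class_function_swap[OF f] x in simp)
    qed (use rep_carrier[OF r x] T in auto)
    from schur_scalar[OF irr T this] obtain c where c: "T = c \<cdot>\<^sub>m 1\<^sub>m d" by blast
    have "of_nat d * c = mat_trace T" unfolding c by (simp add: mat_trace_def)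
    also have "\<dots> = (\<Sum>i<d. \<Sum>g\<in>carrier G. f g * \<rho> g $$ (i, i))"
      by (simp add: mat_trace_def T_def)
    also have "\<dots> = (\<Sum>g\<in>carrier G. f g * \<chi> g)"
      by (subst sum.swap, rule sum.cong[OF refl])
        (use rep_carrier[OF r] in \<open>auto simp: chi character_def mat_trace_def sum_distrib_left\<close>)
    also have "\<dots> = 0" by (rule orth[OF \<chi>])
    finally have "c = 0" using irr_rep_dim_pos[OF irr] by simp
    hence T0: "T = 0\<^sub>m d d" unfolding c by auto
    have "(\<Sum>g\<in>carrier G. f (h \<otimes> g) * \<rho> g $$ (i, i)) = 0" if i: "i < d" for i
      using lT[of "inv h" i i] h i rep_carrier[OF r inv_closed[OF h]] unfolding T0 by simp
    hence "0 = (\<Sum>i<d. \<Sum>g\<in>carrier G. f (h \<otimes> g) * \<rho> g $$ (i, i))" by simp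
    also have "\<dots> = (\<Sum>g\<in>carrier G. f (h \<otimes> g) * \<chi> g)"
      by (subst sum.swap, rule sum.cong[OF refl])
        (use rep_carrier[OF r] in \<open>auto simp: chi character_def mat_trace_def sum_distrib_left\<close>)
    finally show ?thesis ..
  qed
  from is_char_regular obtain d \<rho> where r: "is_rep G d \<rho>"
    and reg: "\<And>g. g \<in> carrier G \<Longrightarrow> mat_trace (\<rho> g) = (if g = \<one> then of_nat gorder else 0)"
    unfolding is_char_def by metis
  have "0 = (\<Sum>g\<in>carrier G. f (h \<otimes> g) * mat_trace (\<rho> g))"
    using orthogonal_to_Irr_imp_chars[OF zero r] by simp
  also have "\<dots> = (\<Sum>g\<in>carrier G. if g = \<one> then f h * of_nat gorder else 0)"
    by (intro sum.cong refl) (use h in \<open>auto simp: reg\<close>)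
  also have "\<dots> = f h * of_nat gorder" using fin by simp
  finally show ?thesis using gorder_pos by simp
qed

section \<open>Counting conjugating elements; centralizers and the class equation\<close>

definition conj_count :: "'a \<Rightarrow> 'a \<Rightarrow> complex" where
  "conj_count g h = (\<Sum>x\<in>carrier G. if x \<otimes> g \<otimes> inv x = h then 1 else 0)"

definition centralizer_order :: "'a \<Rightarrow> nat" where
  "centralizer_order g = card {x \<in> carrier G. x \<otimes> g \<otimes> inv x = g}"

lemma conj_count_self: "conj_count g g = of_nat (centralizer_order g)"
  unfolding conj_count_def centralizer_order_def using fin by (simp add: sum.If_cases Int_def)

lemma conj_count_conjugate_left:
  assumes "x \<in> carrier G" "g \<in> carrier G"
  shows "conj_count (x \<otimes> g \<otimes> inv x) h = conj_count g h"
proof -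
  have "conj_count (x \<otimes> g \<otimes> inv x) h
    = (\<Sum>y\<in>carrier G. if (y \<otimes> x) \<otimes> g \<otimes> inv (y \<otimes> x) = h then 1 else 0)"
    unfolding conj_count_def by (intro sum.cong refl) (use assms in \<open>simp add: inv_mult_group m_assoc\<close>)
  also have "\<dots> = conj_count g h"
    unfolding conj_count_def
    using sum_right_translate[OF assms(1), of "\<lambda>y. if y \<otimes> g \<otimes> inv y = h then 1 else 0"] .
  finally show ?thesis .
qed

lemma conj_count_conjugate_right:
  assumes "x \<in> carrier G" "g \<in> carrier G"
  shows "conj_count g (x \<otimes> g \<otimes> inv x) = of_nat (centralizer_order g)"
proof -
  have iff: "x \<otimes> y \<otimes> g \<otimes> inv (x \<otimes> y) = x \<otimes> g \<otimes> inv x \<longleftrightarrow> y \<otimes> g \<otimes> inv y = g" if y: "y \<in> carrier G" for y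
  proof -
    have "x \<otimes> y \<otimes> g \<otimes> inv (x \<otimes> y) = x \<otimes> (y \<otimes> g \<otimes> inv y) \<otimes> inv x"
      using assms y by (simp add: inv_mult_group m_assoc)
    thus ?thesis using assms y by simp
  qed
  have "conj_count g (x \<otimes> g \<otimes> inv x)
    = (\<Sum>y\<in>carrier G. if (x \<otimes> y) \<otimes> g \<otimes> inv (x \<otimes> y) = x \<otimes> g \<otimes> inv x then 1 else 0)"
    unfolding conj_count_def
    using sum_left_translate[OF assms(1), of "\<lambda>y. if y \<otimes> g \<otimes> inv y = x \<otimes> g \<otimes> inv x then 1 else 0 :: complex"]
    by (rule sym)
  also have "\<dots> = conj_count g g"
    unfolding conj_count_def by (intro sum.cong refl) (simp add: iff)
  finally show ?thesis by (simp add: conj_count_self)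
qed

lemma conj_class_iff: "h \<in> conj_class G g \<longleftrightarrow> (\<exists>x\<in>carrier G. h = x \<otimes> g \<otimes> inv x)"
  unfolding conj_class_def by blast

lemma conj_count_eq:
  assumes "g \<in> carrier G"
  shows "conj_count g h = (if h \<in> conj_class G g then of_nat (centralizer_order g) else 0)"
proof (cases "h \<in> conj_class G g")
  case True
  thus ?thesis using conj_count_conjugate_right assms unfolding conj_class_iff by auto
next
  case False
  hence "x \<otimes> g \<otimes> inv x \<noteq> h" if "x \<in> carrier G" for x using that unfolding conj_class_iff by blast
  thus ?thesis using False by (simp add: conj_count_def)
qed

lemma centralizer_order_conjugate:
  assumes "x \<in> carrier G" "g \<in> carrier G"
  shows "centralizer_order (x \<otimes> g \<otimes> inv x) = centralizer_order g"
proof -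
  have "complex_of_nat (centralizer_order (x \<otimes> g \<otimes> inv x)) = of_nat (centralizer_order g)"
    unfolding conj_count_self[symmetric] conj_count_conjugate_left[OF assms]
    using conj_count_conjugate_right[OF assms] by (simp add: conj_count_self)
  thus ?thesis by simp
qed

lemma conj_class_subset: "g \<in> carrier G \<Longrightarrow> conj_class G g \<subseteq> carrier G"
  unfolding conj_class_def by auto

text \<open>Double counting of the pairs \<open>(x, k)\<close> with x g x^-1 = k: each
  \<open>x\<close> occurs once, each \<open>k\<close> in the class as often as the centralizer has
  elements.\<close>

lemma class_equation:
  assumes g: "g \<in> carrier G"
  shows "card (conj_class G g) * centralizer_order g = gorder"
proof -
  have fc: "finite (conj_class G g)" using conj_class_subset[OF g] fin finite_subset by blast
  have "of_nat gorder = (\<Sum>x\<in>carrier G. \<Sum>k\<in>conj_class G g. if x \<otimes> g \<otimes> inv x = k then 1 else 0 :: complex)"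
  proof -
    have "(\<Sum>k\<in>conj_class G g. if x \<otimes> g \<otimes> inv x = k then 1 else 0 :: complex) = 1" if "x \<in> carrier G" for x
    proof -
      have "x \<otimes> g \<otimes> inv x \<in> conj_class G g" using that by (auto simp: conj_class_iff)
      thus ?thesis using fc by simp
    qed
    thus ?thesis by simp
  qed
  also have "\<dots> = (\<Sum>k\<in>conj_class G g. conj_count g k)"
    unfolding conj_count_def by (rule sum.swap)
  also have "\<dots> = of_nat (card (conj_class G g) * centralizer_order g)"
    by (simp add: conj_count_eq[OF g])
  finally show ?thesis using of_nat_eq_iff by metis
qed

text \<open>Up to the factor |G|, pairing with \<open>conj_count\<close> is evaluation at
  \<open>h\<close>: for each \<open>x\<close> exactly one \<open>g\<close> satisfies x g x^-1 = h,
  and there \<open>u\<close> takes the value u(h).\<close>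

lemma sum_conj_count:
  assumes u: "class_function u" and h: "h \<in> carrier G"
  shows "(\<Sum>g\<in>carrier G. conj_count g h * u g) = of_nat gorder * u h"
proof -
  have "(\<Sum>g\<in>carrier G. conj_count g h * u g)
    = (\<Sum>g\<in>carrier G. \<Sum>x\<in>carrier G. if x \<otimes> g \<otimes> inv x = h then u (x \<otimes> g \<otimes> inv x) else 0)"
    unfolding conj_count_def sum_distrib_right
    by (intro sum.cong refl) (auto simp: class_functionD[OF u])
  also have "\<dots> = (\<Sum>x\<in>carrier G. \<Sum>g\<in>carrier G. if x \<otimes> g \<otimes> inv x = h then u (x \<otimes> g \<otimes> inv x) else 0)"
    by (rule sum.swap)
  also have "\<dots> = (\<Sum>x\<in>carrier G. \<Sum>g\<in>carrier G. if g = h then u g else 0)"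
    by (rule sum.cong[OF refl], rule sum_conjugate)
  also have "\<dots> = of_nat gorder * u h" using fin h by simp
  finally show ?thesis .
qed

lemma Irr_class_function: "\<chi> \<in> Irr G \<Longrightarrow> class_function \<chi>"
  by (rule class_function_is_char[OF is_char_Irr])

text \<open>The difference \<open>f\<close> of the two sides is a class function of
  \<open>g\<close>. Orthonormality and \<open>sum_conj_count\<close> make it orthogonal to every
  irreducible character, so it vanishes by completeness.\<close>

lemma column_orthogonality:
  assumes g: "g \<in> carrier G" and h: "h \<in> carrier G"
  shows "(\<Sum>\<chi>\<in>Irr G. \<chi> g * cnj (\<chi> h)) = conj_count g h"
proof -
  define f where "f = (\<lambda>g. conj_count g h - (\<Sum>\<chi>\<in>Irr G. \<chi> g * cnj (\<chi> h)))"
  have f: "class_function f"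
    unfolding class_function_def f_def
    by (auto simp: conj_count_conjugate_left class_functionD[OF Irr_class_function])
  have orth: "(\<Sum>g\<in>carrier G. f g * cnj (\<psi> g)) = 0" if \<psi>: "\<psi> \<in> Irr G" for \<psi>
  proof -
    have cf: "class_function (\<lambda>g. cnj (\<psi> g))" using Irr_class_function[OF \<psi>] by (simp add: class_function_def)
    have "(\<Sum>g\<in>carrier G. (\<Sum>\<chi>\<in>Irr G. \<chi> g * cnj (\<chi> h)) * cnj (\<psi> g))
      = (\<Sum>\<chi>\<in>Irr G. cnj (\<chi> h) * (\<Sum>g\<in>carrier G. \<chi> g * cnj (\<psi> g)))"
      unfolding sum_distrib_left sum_distrib_right by (subst sum.swap) (simp add: mult_ac)
    also have "\<dots> = (\<Sum>\<chi>\<in>Irr G. if \<chi> = \<psi> then cnj (\<psi> h) * of_nat gorder else 0)"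
    proof (intro sum.cong refl)
      fix \<chi> assume \<chi>: "\<chi> \<in> Irr G"
      have "(\<Sum>g\<in>carrier G. \<chi> g * cnj (\<psi> g)) = of_nat gorder * (if \<chi> = \<psi> then 1 else 0)"
        using Irr_orthonormal[OF \<chi> \<psi>] gorder_pos by (simp add: cf_inner_def divide_eq_eq split: if_splits)
      thus "cnj (\<chi> h) * (\<Sum>g\<in>carrier G. \<chi> g * cnj (\<psi> g)) = (if \<chi> = \<psi> then cnj (\<psi> h) * of_nat gorder else 0)"
        by simp
    qed
    also have "\<dots> = of_nat gorder * cnj (\<psi> h)" using finite_Irr \<psi> by simp
    finally show ?thesis using sum_conj_count[OF cf h] by (simp add: f_def left_diff_distrib sum_subtractf)
  qed
  \<comment> \<open>The completeness lemma pairs with \<chi> rather than its conjugate. Precomposing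
    \<open>f\<close> with inversion converts one pairing into the other.\<close>
  have "f (inv (inv g)) = 0"
  proof (rule class_function_orthogonal_zero[of "\<lambda>g. f (inv g)"])
    show "class_function (\<lambda>g. f (inv g))"
      unfolding class_function_def
    proof (intro ballI)
      fix x g assume xg: "x \<in> carrier G" "g \<in> carrier G"
      have "inv (x \<otimes> g \<otimes> inv x) = x \<otimes> inv g \<otimes> inv x" using xg by (simp add: inv_mult_group m_assoc)
      thus "f (inv (x \<otimes> g \<otimes> inv x)) = f (inv g)" using class_functionD[OF f] xg by simp
    qed
    fix \<chi> assume \<chi>: "\<chi> \<in> Irr G"
    have "(\<Sum>g\<in>carrier G. f (inv g) * \<chi> g) = (\<Sum>g\<in>carrier G. f (inv g) * cnj (\<chi> (inv g)))"
      by (intro sum.cong refl) (simp add: is_char_cyclotomic(2)[OF is_char_Irr[OF \<chi>]])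
    also have "\<dots> = (\<Sum>g\<in>carrier G. f g * cnj (\<chi> g))" by (rule sum_inv)
    finally show "(\<Sum>g\<in>carrier G. f (inv g) * \<chi> g) = 0" using orth[OF \<chi>] by simp
  qed (use g in simp)
  thus ?thesis using g by (simp add: f_def)
qed

end

section \<open>Classes of defect zero\<close>

context finite_grp
begin

lemma conj_class_eq:
  assumes g: "g \<in> carrier G" and h: "h \<in> conj_class G g"
  shows "conj_class G h = conj_class G g"
proof -
  from h obtain x where x: "x \<in> carrier G" "h = x \<otimes> g \<otimes> inv x" unfolding conj_class_iff by blast
  have sub: "conj_class G (x \<otimes> g \<otimes> inv x) \<subseteq> conj_class G g" if "x \<in> carrier G" "g \<in> carrier G" for x g
  proof
    fix k assume "k \<in> conj_class G (x \<otimes> g \<otimes> inv x)"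
    then obtain y where y: "y \<in> carrier G" "k = y \<otimes> (x \<otimes> g \<otimes> inv x) \<otimes> inv y" unfolding conj_class_iff by blast
    hence "k = (y \<otimes> x) \<otimes> g \<otimes> inv (y \<otimes> x)" using that by (simp add: inv_mult_group m_assoc)
    thus "k \<in> conj_class G g" using that y unfolding conj_class_iff by blast
  qed
  have "g = inv x \<otimes> h \<otimes> inv (inv x)" using x g by (simp add: m_assoc inv_solve_left)
  hence "conj_class G g \<subseteq> conj_class G h" using sub[of "inv x" h] x g by simp
  thus ?thesis using sub[OF x(1) g] x(2) by blast
qed

lemma conj_class_self: "g \<in> carrier G \<Longrightarrow> g \<in> conj_class G g"
  unfolding conj_class_iff by (intro bexI[of _ \<one>]) auto

text \<open>Inversion commutes with conjugation, so one element conjugate to its inverse makes the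
  whole class closed under inversion.\<close>

lemma real_class_iff:
  assumes g: "g \<in> carrier G"
  shows "real_class G (conj_class G g) \<longleftrightarrow> inv g \<in> conj_class G g"
proof
  assume "real_class G (conj_class G g)"
  thus "inv g \<in> conj_class G g" using conj_class_self[OF g] unfolding real_class_def by blast
next
  assume "inv g \<in> conj_class G g"
  then obtain y where y: "y \<in> carrier G" "inv g = y \<otimes> g \<otimes> inv y" unfolding conj_class_iff by blast
  have closed: "inv k \<in> conj_class G g" if k: "k \<in> conj_class G g" for k
  proof -
    from k obtain x where x: "x \<in> carrier G" "k = x \<otimes> g \<otimes> inv x" unfolding conj_class_iff by blast
    hence "inv k = x \<otimes> inv g \<otimes> inv x" using g by (simp add: inv_mult_group m_assoc)
    also have "\<dots> = (x \<otimes> y) \<otimes> g \<otimes> inv (x \<otimes> y)" unfolding y(2) using x y(1) g by (simp add: inv_mult_group m_assoc)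
    finally show ?thesis using x y unfolding conj_class_iff by blast
  qed
  show "real_class G (conj_class G g)"
    unfolding real_class_def
  proof
    show "(\<lambda>x. inv x) ` conj_class G g \<subseteq> conj_class G g" using closed by blast
    show "conj_class G g \<subseteq> (\<lambda>x. inv x) ` conj_class G g"
    proof
      fix k assume k: "k \<in> conj_class G g"
      hence "k = inv (inv k)" using conj_class_subset[OF g] by auto
      thus "k \<in> (\<lambda>x. inv x) ` conj_class G g" using closed[OF k] by blast
    qed
  qed
qed

text \<open>The multiplicities of \<open>p\<close> in the class size and in the centralizer order
  add up to that in |G|, by the class equation.\<close>

lemma p_defect_zero_iff:
  assumes p: "prime p" and g: "g \<in> carrier G"
  shows "p_defect_zero G p (conj_class G g) \<longleftrightarrow> \<not> p dvd centralizer_order g"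
proof -
  have "card (conj_class G g) \<noteq> 0" "centralizer_order g \<noteq> 0"
    using class_equation[OF g] gorder_pos by (metis mult_is_0 not_less_zero)+
  hence "multiplicity p gorder = multiplicity p (card (conj_class G g)) + multiplicity p (centralizer_order g)"
    using p prime_elem_multiplicity_mult_distrib[of p "card (conj_class G g)" "centralizer_order g"] class_equation[OF g] by simp
  moreover have "p > 1" using p by (rule prime_gt_1_nat)
  ultimately have "p_defect_zero G p (conj_class G g) \<longleftrightarrow> multiplicity p (centralizer_order g) = 0"
    by (simp add: p_defect_zero_def p_part_def)
  also have "\<dots> \<longleftrightarrow> \<not> p dvd centralizer_order g"
    using p \<open>centralizer_order g \<noteq> 0\<close> by (simp add: prime_elem_multiplicity_eq_zero_iff)
  finally show ?thesis .
qed

section \<open>The divisibility criterion for a conjugation invariant set\<close>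

context
  fixes S :: "'a set" and p n :: nat and \<theta> :: "'a \<Rightarrow> complex"
  assumes S: "S \<subseteq> carrier G"
    and S_conj: "\<And>x g. x \<in> carrier G \<Longrightarrow> g \<in> S \<Longrightarrow> x \<otimes> g \<otimes> inv x \<in> S"
    and p: "prime p" and n: "n \<ge> 2"
  defines "\<theta> \<equiv> \<lambda>g. if g \<in> S then of_nat (centralizer_order g) else 0"
begin

lemma class_function_theta_pow: "class_function (\<lambda>g. \<theta> g ^ n)"
  unfolding class_function_def
proof (intro ballI)
  fix x g assume xg: "x \<in> carrier G" "g \<in> carrier G"
  have "g \<in> S" if "x \<otimes> g \<otimes> inv x \<in> S"
  proof -
    have "inv x \<otimes> (x \<otimes> g \<otimes> inv x) \<otimes> inv (inv x) \<in> S" using S_conj[OF _ that] xg by blast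
    moreover have "inv x \<otimes> (x \<otimes> g \<otimes> inv x) \<otimes> inv (inv x) = g" using xg
      by (simp add: m_assoc) (simp add: m_assoc[symmetric])
    ultimately show ?thesis by simp
  qed
  thus "\<theta> (x \<otimes> g \<otimes> inv x) ^ n = \<theta> g ^ n"
    using xg S_conj centralizer_order_conjugate[OF xg] by (auto simp: \<theta>_def)
qed

text \<open>On a class the summand is constant. The class size times one centralizer factor is |G|,
  which cancels the denominator and leaves the exponent \<open>n - 1\<close>.
  \<open>inv_into\<close> picks a representative of each class inside \<open>S\<close>.\<close>

lemma sum_over_classes:
  assumes \<phi>: "class_function \<phi>"
  shows "(\<Sum>g\<in>carrier G. \<phi> g * \<theta> g ^ n) / of_nat gorder
    = (\<Sum>K\<in>conj_class G ` S. of_nat (centralizer_order (inv_into S (conj_class G) K) ^ (n - 1)) * \<phi> (inv_into S (conj_class G) K))"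
proof -
  let ?r = "inv_into S (conj_class G)"
  have fS: "finite S" using S fin finite_subset by blast
  have "(\<Sum>g\<in>carrier G. \<phi> g * \<theta> g ^ n) = (\<Sum>g\<in>S. \<phi> g * of_nat (centralizer_order g) ^ n)"
    using S n fin by (intro sum.mono_neutral_cong_right) (auto simp: \<theta>_def)
  also have "\<dots> = (\<Sum>K\<in>conj_class G ` S. \<Sum>g\<in>{g\<in>S. conj_class G g = K}. \<phi> g * of_nat (centralizer_order g) ^ n)"
    using fS by (intro sum.group[symmetric]) auto
  also have "\<dots> = (\<Sum>K\<in>conj_class G ` S. of_nat gorder * (of_nat (centralizer_order (?r K) ^ (n - 1)) * \<phi> (?r K)))"
  proof (intro sum.cong refl)
    fix K assume K: "K \<in> conj_class G ` S"
    have r: "?r K \<in> S" "conj_class G (?r K) = K" using K by (rule inv_into_into, rule f_inv_into_f)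
    hence rc: "?r K \<in> carrier G" using S by blast
    have "{g\<in>S. conj_class G g = K} = K"
    proof
      show "{g\<in>S. conj_class G g = K} \<subseteq> K" using conj_class_self S by blast
      show "K \<subseteq> {g\<in>S. conj_class G g = K}"
      proof
        fix g assume "g \<in> K"
        hence g: "g \<in> conj_class G (?r K)" using r by simp
        hence "conj_class G g = K" using conj_class_eq[OF rc] r by simp
        moreover have "g \<in> S" using g S_conj r(1) unfolding conj_class_iff by blast
        ultimately show "g \<in> {g\<in>S. conj_class G g = K}" by simp
      qed
    qed
    moreover have "\<phi> g * of_nat (centralizer_order g) ^ n = \<phi> (?r K) * of_nat (centralizer_order (?r K)) ^ n"
      if "g \<in> K" for g
    proof -
      have "g \<in> conj_class G (?r K)" using that r by simp
      then obtain x where x: "x \<in> carrier G" "g = x \<otimes> ?r K \<otimes> inv x" unfolding conj_class_iff by blast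
      show ?thesis unfolding x(2) class_functionD[OF \<phi> x(1) rc] centralizer_order_conjugate[OF x(1) rc] ..
    qed
    ultimately have "(\<Sum>g\<in>{g\<in>S. conj_class G g = K}. \<phi> g * of_nat (centralizer_order g) ^ n)
      = of_nat (card K) * (\<phi> (?r K) * of_nat (centralizer_order (?r K)) ^ n)" by simp
    also have "\<dots> = of_nat (card K * centralizer_order (?r K)) * (of_nat (centralizer_order (?r K) ^ (n - 1)) * \<phi> (?r K))"
      using n by (cases n) (auto simp: mult_ac)
    also have "card K * centralizer_order (?r K) = gorder" using class_equation[OF rc] r by simp
    finally show "(\<Sum>g\<in>{g\<in>S. conj_class G g = K}. \<phi> g * of_nat (centralizer_order g) ^ n)
      = of_nat gorder * (of_nat (centralizer_order (?r K) ^ (n - 1)) * \<phi> (?r K))" .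
  qed
  finally show ?thesis using gorder_pos by (simp add: sum_distrib_left[symmetric])
qed

text \<open>Applied with the whole group as \<open>S\<close> for \<open>gamma_n\<close> and with the
  elements conjugate to their inverses for \<open>delta_n\<close>. Integrality is a hypothesis here
  because it comes from characters, not from the shape of \<open>\<theta>\<close>.\<close>

lemma defect_zero_criterion:
  assumes int: "\<And>\<phi>. \<phi> \<in> Irr G \<Longrightarrow> (\<Sum>g\<in>carrier G. \<phi> g * \<theta> g ^ n) / of_nat gorder \<in> \<int>"
  shows "(\<exists>g\<in>S. \<not> p dvd centralizer_order g)
    \<longleftrightarrow> (\<exists>\<phi>\<in>Irr G. not_div_by p ((\<Sum>g\<in>carrier G. \<phi> g * \<theta> g ^ n) / of_nat gorder))"
    (is "?L \<longleftrightarrow> ?R")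
proof
  let ?F = "\<lambda>\<phi>. (\<Sum>g\<in>carrier G. \<phi> g * \<theta> g ^ n) / of_nat gorder"
  have p0: "complex_of_nat p \<noteq> 0" using p by (simp add: prime_gt_0_nat)
  have divisible: "\<exists>m::int. z = of_int (int p * m)"
    if z: "z \<in> \<int>" "z / of_nat p \<in> cyclotomic_ints gorder" for z :: complex
  proof -
    have "z / of_nat p \<in> \<rat>" using z(1) Ints_subset_Rats by (intro Rats_divide) auto
    hence "z / of_nat p \<in> \<int>" using cyclotomic_ints_rational gorder_pos z(2) by blast
    then obtain m :: int where "z / of_nat p = of_int m" by (elim Ints_cases)
    hence "z = of_int (int p * m)" using p0 by (simp add: field_simps)
    thus ?thesis by blast
  qed
  {
    assume ?R
    then obtain \<phi> where \<phi>: "\<phi> \<in> Irr G" and nd: "not_div_by p (?F \<phi>)" by blast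
    show ?L
    proof (rule ccontr)
      assume "\<not> ?L"
      let ?r = "inv_into S (conj_class G)"
      have r: "?r K \<in> S" if "K \<in> conj_class G ` S" for K using that by (rule inv_into_into)
      have "\<forall>K\<in>conj_class G ` S. \<exists>c. centralizer_order (?r K) ^ (n - 1) = p * c"
      proof
        fix K assume "K \<in> conj_class G ` S"
        hence "p dvd centralizer_order (?r K)" using r \<open>\<not> ?L\<close> by blast
        \<comment> \<open>Here n \<ge> 2 matters: the exponent \<open>n - 1\<close> is at least
          1.\<close>
        hence "p dvd centralizer_order (?r K) ^ (n - 1)" using n by (intro dvd_power_le[of p _ 1, simplified]) auto
        thus "\<exists>c. centralizer_order (?r K) ^ (n - 1) = p * c" by (elim dvdE) blast
      qed
      then obtain c where c: "\<And>K. K \<in> conj_class G ` S \<Longrightarrow> centralizer_order (?r K) ^ (n - 1) = p * c K" by metis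
      have "?F \<phi> = (\<Sum>K\<in>conj_class G ` S. of_nat (p * c K) * \<phi> (?r K))"
        unfolding sum_over_classes[OF Irr_class_function[OF \<phi>]] by (intro sum.cong refl) (simp only: c)
      also have "\<dots> = of_nat p * (\<Sum>K\<in>conj_class G ` S. of_int (int (c K)) * \<phi> (?r K))"
        by (simp add: sum_distrib_left mult.assoc)
      finally have "?F \<phi> / of_nat p = (\<Sum>K\<in>conj_class G ` S. of_int (int (c K)) * \<phi> (?r K))"
        using p0 by simp
      moreover have "\<dots> \<in> cyclotomic_ints gorder"
        by (rule cyclotomic_ints_sum) (use r S is_char_cyclotomic(1)[OF is_char_Irr[OF \<phi>]] in blast)
      ultimately have "?F \<phi> / of_nat p \<in> cyclotomic_ints gorder" by simp
      from divisible[OF int[OF \<phi>] this] show False using nd unfolding not_div_by_def by blast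
    qed
  }
  assume ?L
  then obtain h where hS: "h \<in> S" and nd: "\<not> p dvd centralizer_order h" by blast
  hence h: "h \<in> carrier G" using S by blast
  show ?R
  proof (rule ccontr)
    assume "\<not> ?R"
    hence "\<forall>\<phi>\<in>Irr G. \<exists>m::int. ?F \<phi> = of_int (int p * m)" unfolding not_div_by_def by blast
    then obtain m :: "_ \<Rightarrow> int" where m: "\<And>\<phi>. \<phi> \<in> Irr G \<Longrightarrow> ?F \<phi> = of_int (int p * m \<phi>)" by metis
    \<comment> \<open>Fourier inversion: the value at \<open>h\<close> is recovered from the
      coefficients by expanding \<open>conj_count\<close> through column orthogonality.\<close>
    have "of_nat gorder * of_nat (centralizer_order h) ^ n = of_nat gorder * \<theta> h ^ n" using hS by (simp add: \<theta>_def)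
    also have "\<dots> = (\<Sum>g\<in>carrier G. conj_count g h * \<theta> g ^ n)"
      by (rule sum_conj_count[OF class_function_theta_pow h, symmetric])
    also have "\<dots> = (\<Sum>g\<in>carrier G. \<Sum>\<phi>\<in>Irr G. \<phi> g * cnj (\<phi> h) * \<theta> g ^ n)"
      by (intro sum.cong refl) (simp add: column_orthogonality[OF _ h, symmetric] sum_distrib_right)
    also have "\<dots> = (\<Sum>\<phi>\<in>Irr G. cnj (\<phi> h) * (\<Sum>g\<in>carrier G. \<phi> g * \<theta> g ^ n))"
      by (subst sum.swap) (simp add: sum_distrib_left mult_ac)
    also have "\<dots> = (\<Sum>\<phi>\<in>Irr G. of_nat gorder * (of_int (int p * m \<phi>) * \<phi> (inv h)))"
    proof (intro sum.cong refl)
      fix \<phi> assume \<phi>: "\<phi> \<in> Irr G"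
      have "(\<Sum>g\<in>carrier G. \<phi> g * \<theta> g ^ n) = of_nat gorder * of_int (int p * m \<phi>)"
        using m[OF \<phi>] gorder_pos by (simp add: divide_eq_eq mult.commute)
      \<comment> \<open>As a character value at \<open>inv h\<close>, the conjugate is visibly a
        cyclotomic integer.\<close>
      moreover have "cnj (\<phi> h) = \<phi> (inv h)" using is_char_cyclotomic(2)[OF is_char_Irr[OF \<phi>] h] by simp
      ultimately show "cnj (\<phi> h) * (\<Sum>g\<in>carrier G. \<phi> g * \<theta> g ^ n) = of_nat gorder * (of_int (int p * m \<phi>) * \<phi> (inv h))"
        by (simp add: mult_ac)
    qed
    also have "\<dots> = of_nat gorder * (of_nat p * (\<Sum>\<phi>\<in>Irr G. of_int (m \<phi>) * \<phi> (inv h)))"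
      by (simp add: sum_distrib_left mult.assoc)
    finally have "of_nat (centralizer_order h) ^ n / of_nat p = (\<Sum>\<phi>\<in>Irr G. of_int (m \<phi>) * \<phi> (inv h))"
      using p0 gorder_pos by simp
    moreover have "\<dots> \<in> cyclotomic_ints gorder"
      by (rule cyclotomic_ints_sum) (use h is_char_cyclotomic(1)[OF is_char_Irr] in auto)
    ultimately have "of_nat (centralizer_order h) ^ n / of_nat p \<in> cyclotomic_ints gorder" by simp
    from divisible[OF _ this] obtain l :: int
      where "complex_of_nat (centralizer_order h) ^ n = of_int (int p * l)" by (auto simp: Ints_power)
    hence "complex_of_int (int (centralizer_order h) ^ n) = of_int (int p * l)" by simp
    hence "int (centralizer_order h) ^ n = int p * l" unfolding of_int_eq_iff .
    hence "int p dvd int (centralizer_order h ^ n)" by simp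
    hence "p dvd centralizer_order h ^ n" unfolding int_dvd_int_iff .
    thus False using nd p prime_dvd_power by blast
  qed
qed

end

section \<open>Integrality and closed forms of the two invariants\<close>

lemma sum_Irr_prod:
  "(\<Sum>\<chi>\<in>Pi\<^sub>E {..<n} (\<lambda>_. Irr G). cf_inner G \<phi> (\<lambda>g. \<Prod>i<n. f (\<chi> i) g))
    = (\<Sum>g\<in>carrier G. \<phi> g * cnj ((\<Sum>\<chi>\<in>Irr G. f \<chi> g) ^ n)) / of_nat gorder"
proof -
  have "(\<Sum>\<chi>\<in>Pi\<^sub>E {..<n} (\<lambda>_. Irr G). cf_inner G \<phi> (\<lambda>g. \<Prod>i<n. f (\<chi> i) g))
    = (\<Sum>g\<in>carrier G. \<phi> g * cnj (\<Sum>\<chi>\<in>Pi\<^sub>E {..<n} (\<lambda>_. Irr G). \<Prod>i<n. f (\<chi> i) g)) / of_nat gorder"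
    unfolding cf_inner_def sum_divide_distrib[symmetric]
    by (subst sum.swap) (simp only: cnj_sum sum_distrib_left)
  \<comment> \<open>Distributivity: the sum over all \<open>n\<close>-tuples of the products is the
    \<open>n\<close>-th power of the sum over \<open>Irr G\<close>, which is finite.\<close>
  also have "(\<lambda>g. \<Sum>\<chi>\<in>Pi\<^sub>E {..<n} (\<lambda>_. Irr G). \<Prod>i<n. f (\<chi> i) g) = (\<lambda>g. (\<Sum>\<chi>\<in>Irr G. f \<chi> g) ^ n)"
  proof
    fix g
    show "(\<Sum>\<chi>\<in>Pi\<^sub>E {..<n} (\<lambda>_. Irr G). \<Prod>i<n. f (\<chi> i) g) = (\<Sum>\<chi>\<in>Irr G. f \<chi> g) ^ n"
      using prod_sum_PiE[of "{..<n}" "\<lambda>_. Irr G" "\<lambda>_ \<chi>. f \<chi> g"] finite_Irr by simp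
  qed
  finally show ?thesis .
qed

lemma gamma_n_Ints:
  assumes "\<phi> \<in> Irr G"
  shows "gamma_n G n \<phi> \<in> \<int>"
  unfolding gamma_n_def
  by (intro Ints_sum cf_inner_Ints is_char_Irr[OF assms] is_char_prod is_char_mult is_char_cnj is_char_Irr) auto

lemma delta_n_Ints:
  assumes "\<phi> \<in> Irr G"
  shows "delta_n G n \<phi> \<in> \<int>"
  unfolding delta_n_def power2_eq_square
  by (intro Ints_sum cf_inner_Ints is_char_Irr[OF assms] is_char_prod is_char_mult is_char_Irr) auto

text \<open>Column orthogonality with both columns at \<open>g\<close>. The conditional is always
  true under the sum; it reproduces the shape of \<open>\<theta>\<close> for the whole
  group.\<close>

lemma gamma_n_eq:
  "gamma_n G n \<phi> = (\<Sum>g\<in>carrier G. \<phi> g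
    * (if g \<in> carrier G then of_nat (centralizer_order g) else 0) ^ n) / of_nat gorder"
  unfolding gamma_n_def sum_Irr_prod[where f = "\<lambda>\<chi> g. \<chi> g * cnj (\<chi> g)"]
  by (intro arg_cong2[where f = "(/)"] sum.cong refl) (simp add: column_orthogonality conj_count_self)

text \<open>Since \<chi>(g) is the conjugate of \<chi>(g^-1), the sum of squares is column
  orthogonality for \<open>g\<close> and \<open>inv g\<close>, which vanishes unless these are
  conjugate.\<close>

lemma delta_n_eq:
  "delta_n G n \<phi> = (\<Sum>g\<in>carrier G. \<phi> g
    * (if g \<in> {g \<in> carrier G. inv g \<in> conj_class G g} then of_nat (centralizer_order g) else 0) ^ n) / of_nat gorder"
proof -
  have "(\<Sum>\<chi>\<in>Irr G. (\<chi> g)\<^sup>2) = (if inv g \<in> conj_class G g then of_nat (centralizer_order g) else 0)"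
    if g: "g \<in> carrier G" for g
  proof -
    have "(\<Sum>\<chi>\<in>Irr G. (\<chi> g)\<^sup>2) = (\<Sum>\<chi>\<in>Irr G. \<chi> g * cnj (\<chi> (inv g)))"
      by (intro sum.cong refl) (simp add: is_char_cyclotomic(2)[OF is_char_Irr g] power2_eq_square)
    thus ?thesis using g by (simp add: column_orthogonality conj_count_eq)
  qed
  thus ?thesis
    unfolding delta_n_def sum_Irr_prod[where f = "\<lambda>\<chi> g. (\<chi> g)\<^sup>2"]
    by (intro arg_cong2[where f = "(/)"] sum.cong refl) simp
qed

end

theorem theorem4:
  fixes G :: "('a, 'b) monoid_scheme" and p n :: nat
  assumes "group G" and "finite (carrier G)" and "prime p" and "n \<ge> 2"
  shows "((\<exists>K. is_conj_class G K \<and> p_defect_zero G p K) \<longleftrightarrow>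
            (\<exists>\<phi> \<in> Irr G. not_div_by p (gamma_n G n \<phi>)))
       \<and> ((\<exists>K. is_conj_class G K \<and> real_class G K \<and> p_defect_zero G p K) \<longleftrightarrow>
            (\<exists>\<phi> \<in> Irr G. not_div_by p (delta_n G n \<phi>)))"
proof -
  interpret finite_grp G using assms(1,2) by (simp add: finite_grp_def finite_grp_axioms_def)
  let ?R = "{g \<in> carrier G. inv\<^bsub>G\<^esub> g \<in> conj_class G g}"
  have "(\<exists>g\<in>carrier G. \<not> p dvd centralizer_order g) \<longleftrightarrow> (\<exists>\<phi>\<in>Irr G. not_div_by p (gamma_n G n \<phi>))"
    unfolding gamma_n_eq
    by (rule defect_zero_criterion[OF _ _ assms(3,4)]) (use gamma_n_Ints[unfolded gamma_n_eq] in auto)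
  moreover have "(\<exists>g\<in>?R. \<not> p dvd centralizer_order g) \<longleftrightarrow> (\<exists>\<phi>\<in>Irr G. not_div_by p (delta_n G n \<phi>))"
    unfolding delta_n_eq
  proof (rule defect_zero_criterion[OF _ _ assms(3,4)])
    fix x g assume x: "x \<in> carrier G" and g: "g \<in> ?R"
    let ?h = "x \<otimes>\<^bsub>G\<^esub> g \<otimes>\<^bsub>G\<^esub> inv\<^bsub>G\<^esub> x"
    have gc: "g \<in> carrier G" using g by simp
    have h: "?h \<in> conj_class G g" using x by (auto simp: conj_class_iff)
    \<comment> \<open>Membership in \<open>?R\<close> is a property of the conjugacy class, so it
      passes from \<open>g\<close> to its conjugates.\<close>
    have "real_class G (conj_class G ?h)"
      using g real_class_iff[OF gc] conj_class_eq[OF gc h] by simp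
    thus "?h \<in> ?R" using x gc real_class_iff[of ?h] by simp
  qed (use delta_n_Ints[unfolded delta_n_eq] in auto)
  moreover have "(\<exists>K. is_conj_class G K \<and> p_defect_zero G p K)
      \<longleftrightarrow> (\<exists>g\<in>carrier G. \<not> p dvd centralizer_order g)"
    unfolding is_conj_class_def using p_defect_zero_iff[OF assms(3)] by blast
  moreover have "(\<exists>K. is_conj_class G K \<and> real_class G K \<and> p_defect_zero G p K)
      \<longleftrightarrow> (\<exists>g\<in>?R. \<not> p dvd centralizer_order g)"
    unfolding is_conj_class_def using p_defect_zero_iff[OF assms(3)] real_class_iff by blast
  ultimately show ?thesis by simp
qed

end
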